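(* Let $X=(X(t))_{t\ge 0}$ be a real-valued Lévy process with triplet $(\sigma^2,b,\nu)$, where $\nu(\mathbb{R}_-)>0$. Let $f\colon\mathbb{R}_+\to\mathbb{R}_+$ be a differentiable, non-decreasing function such that $f(0)<1$, $\int_1^\infty f'(s)^2\,ds<\infty$, and $f'(t)\searrow 0$ (i.e. $f'$ decreases to $0$) as $t\to\infty$. Let $\delta>0$. If $$\mathbb{P}\left(X(t)\le 1,\ 0\le t\le T\right)=T^{-\delta+o(1)},\qquad T\to\infty,$$ then $$\mathbb{P}\left(X(t)\le 1-f(t),\ 0\le t\le T\right)=T^{-\delta+o(1)},\qquad T\to\infty.$$
   Context: A Lévy process here is a real-valued process starting at $0$ with stationary and independent increments and almost surely càdlàg paths. It has triplet $(\sigma^2,b,\nu)$, with $\sigma^2\ge 0$, $b\in\mathbb{R}$ and $\nu$ a positive measure concentrated on $\mathbb{R}\setminus\{0\}$ (the Lévy measure) satisfying $\int_{\mathbb{R}}(1\wedge x^2)\,\nu(dx)<\infty$, if $\mathbb{E}(e^{iuX(t)})=e^{t\Psi(u)}$ for all $u\in\mathbb{R}$, $t\ge 0$, where $$\Psi(u)=ibu-\frac{\sigma^2}{2}u^2+\int_{\mathbb{R}}\left(e^{iux}-1-\mathbf{1}_{\{|x|\le 1\}}iux\right)\nu(dx).$$ $\mathbb{R}_+=[0,\infty)$ as the domain and range of $f$; $\nu(\mathbb{R}_-)$ is the $\nu$-mass of the negative half-line. $\mathbb{P}(X(t)\le g(t),\ 0\le t\le T)$ denotes the probability that $X(t)\le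 g(t)$ holds for all $t\in[0,T]$. For a function $p$, "$p(T)=T^{-\delta+o(1)}$ as $T\to\infty$" means $p(T)>0$ for large $T$ and $\ln p(T)/\ln T\to-\delta$ as $T\to\infty$. *)

theory Defs
  imports "HOL-Probability.Probability"
begin

definition cadlag :: "(real \<Rightarrow> real) \<Rightarrow> bool" where
  "cadlag x \<longleftrightarrow>
     (\<forall>t\<ge>0. continuous (at_right t) x) \<and> (\<forall>t>0. \<exists>l. (x \<longlongrightarrow> l) (at_left t))"

text \<open>
  The time set is the half-line of nonnegative reals; values of \<open>X t\<close> for
  negative \<open>t\<close> are irrelevant.
\<close>

locale levy_process = prob_space M for M :: "'a measure" +
  fixes X :: "real \<Rightarrow> 'a \<Rightarrow> real"
  assumes random_variable_at: "t \<ge> 0 \<Longrightarrow> X t \<in> borel_measurable M"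
    and starts_at_0: "AE \<omega> in M. X 0 \<omega> = 0"
    and stationary_increments:
      "0 \<le> s \<Longrightarrow> s \<le> t \<Longrightarrow>
         distr M borel (\<lambda>\<omega>. X t \<omega> - X s \<omega>) = distr M borel (X (t - s))"
    and independent_increments:
      "0 \<le> \<tau> 0 \<Longrightarrow> (\<And>i. i < n \<Longrightarrow> \<tau> i < \<tau> (Suc i)) \<Longrightarrow>
         indep_vars (\<lambda>_. borel) (\<lambda>i \<omega>. X (\<tau> (Suc i)) \<omega> - X (\<tau> i) \<omega>) {..<n::nat}"
    and cadlag_paths: "AE \<omega> in M. cadlag (\<lambda>t. X t \<omega>)"

definition levy_measure :: "real measure \<Rightarrow> bool" where
  "levy_measure \<nu> \<longleftrightarrow>
     sets \<nu> = sets borel \<and> emeasure \<nu> {0} = 0 \<and>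
     (\<integral>\<^sup>+x. ennreal (min 1 (x\<^sup>2)) \<partial>\<nu>) < \<infinity>"

definition levy_exponent :: "real \<Rightarrow> real \<Rightarrow> real measure \<Rightarrow> real \<Rightarrow> complex" where
  "levy_exponent \<sigma>2 b \<nu> u =
     \<i> * of_real (b * u) - of_real (\<sigma>2 / 2 * u\<^sup>2) +
     (\<integral>x. (exp (\<i> * of_real (u * x)) - 1
            - (if \<bar>x\<bar> \<le> 1 then \<i> * of_real (u * x) else 0)) \<partial>\<nu>)"

text \<open>The first parameter of the triplet is the variance \<open>\<sigma>\<^sup>2\<close> itself, not \<open>\<sigma>\<close>.\<close>

definition has_levy_triplet ::
    "'a measure \<Rightarrow> (real \<Rightarrow> 'a \<Rightarrow> real) \<Rightarrow> real \<Rightarrow> real \<Rightarrow> real measure \<Rightarrow> bool" where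
  "has_levy_triplet M X \<sigma>2 b \<nu> \<longleftrightarrow>
     \<sigma>2 \<ge> 0 \<and> levy_measure \<nu> \<and>
     (\<forall>u. \<forall>t\<ge>0. (\<integral>\<omega>. exp (\<i> * of_real (u * X t \<omega>)) \<partial>M) =
                  exp (of_real t * levy_exponent \<sigma>2 b \<nu> u))"

text \<open>
  The event is an uncountable intersection and paths are only almost surely
  cadlag, so for continuous \<open>g\<close> it is measurable up to a null set only. As
  \<^const>\<open>measure\<close> is 0 on non-measurable sets, the probability is taken in the
  completion of \<open>M\<close>.
\<close>

definition prob_below ::
    "'a measure \<Rightarrow> (real \<Rightarrow> 'a \<Rightarrow> real) \<Rightarrow> (real \<Rightarrow> real) \<Rightarrow> real \<Rightarrow> real" where
  "prob_below M X g T =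
     measure (completion M) {\<omega> \<in> space M. \<forall>t\<in>{0..T}. X t \<omega> \<le> g t}"

text \<open>\<open>p(T) = T powr (-\<delta> + o(1))\<close> as \<open>T\<close> tends to infinity.\<close>

definition decays_with_exponent :: "(real \<Rightarrow> real) \<Rightarrow> real \<Rightarrow> bool" where
  "decays_with_exponent p \<delta> \<longleftrightarrow>
     (\<forall>\<^sub>F T in at_top. p T > 0) \<and> ((\<lambda>T. ln (p T) / ln T) \<longlongrightarrow> - \<delta>) at_top"

end

theory Submission
  imports Defs
begin

text \<open>
  The upper bound is monotonicity. For the lower bound discretise time with mesh \<open>h\<close>, so that \<open>X\<close>
  becomes a random walk with step law \<open>\<mu>\<^sub>h\<close>. Because \<open>\<nu>\<close> charges the negative half-line, there are
  \<open>\<epsilon>, \<rho> > 0\<close> with \<open>\<mu>\<^sub>h {..-\<epsilon>} \<ge> \<rho> h\<close> for small \<open>h\<close>. Now replace, independently and with probability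
  proportional to \<open>h f'(t)\<close>, the step at time \<open>t\<close> by a step conditioned to be at most \<open>-\<epsilon>\<close>. Given the
  set of replaced steps, the others form a random walk of the original kind, and a
  supermartingale estimate shows that the replaced steps push the walk below \<open>-f\<close>, up to a
  constant, with positive probability. So the modified walk stays below the moving boundary with a
  probability comparable to that of the original walk staying below a constant. The density of the
  modified walk has \<open>p\<close>-th moment bounded by \<open>exp (C \<integral> f'\<^sup>2)\<close>, uniformly in \<open>h\<close> and \<open>T\<close>, and
  Hoelder's inequality with \<open>p\<close> arbitrarily large transfers the exponent. The constant is absorbed by
  letting the walk first descend far enough during a short initial period, which is a second
  application of the same estimate.
\<close>

subsection \<open>Survival probabilities of random walks\<close>

text \<open>
  The expectation of the product of the weights \<open>D k\<close>, evaluated at the steps, on the event that a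
  random walk started at \<open>x\<close> with step laws \<open>\<mu> k\<close> satisfies \<open>S\<^sub>k\<^sub>+\<^sub>1 \<le> b k\<close> for all \<open>k < n\<close>.
\<close>

fun surv :: "(nat \<Rightarrow> real measure) \<Rightarrow> (nat \<Rightarrow> real \<Rightarrow> real) \<Rightarrow> (nat \<Rightarrow> real) \<Rightarrow> nat \<Rightarrow> real \<Rightarrow> real" where
  "surv \<mu> D b 0 x = 1"
| "surv \<mu> D b (Suc n) x =
     (\<integral>v. D 0 v * (indicator {..b 0} (x + v)
        * surv (\<lambda>k. \<mu> (Suc k)) (\<lambda>k. D (Suc k)) (\<lambda>k. b (Suc k)) n (x + v)) \<partial>\<mu> 0)"

text \<open>The common bound \<open>B\<close> secures integrability: \<open>surv\<close> after
  \<open>n\<close> steps is at most \<open>B ^ n\<close>.\<close>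

definition step_weights :: "real \<Rightarrow> (nat \<Rightarrow> real measure) \<Rightarrow> (nat \<Rightarrow> real \<Rightarrow> real) \<Rightarrow> bool" where
  "step_weights B \<mu> D \<longleftrightarrow>
     (\<forall>k. real_distribution (\<mu> k) \<and> D k \<in> borel_measurable borel \<and> (\<forall>v. 0 \<le> D k v \<and> D k v \<le> B))"

lemma step_weights_Suc:
  "step_weights B \<mu> D \<Longrightarrow> step_weights B (\<lambda>k. \<mu> (Suc k)) (\<lambda>k. D (Suc k))"
  by (simp add: step_weights_def)

lemma step_weights_one:
  "(\<And>k. real_distribution (\<mu> k)) \<Longrightarrow> step_weights 1 \<mu> (\<lambda>_ _. 1)"
  by (simp add: step_weights_def)

text \<open>Measurability and boundedness go through one induction, because the recursive integral
  is controlled only when both are known for the remaining steps.\<close>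

lemma surv_measurable_bounds:
  assumes "step_weights B \<mu> D"
  shows "surv \<mu> D b n \<in> borel_measurable borel \<and> (\<forall>x. 0 \<le> surv \<mu> D b n x \<and> surv \<mu> D b n x \<le> B ^ n)"
  using assms
proof (induction n arbitrary: \<mu> D b)
  case 0
  then show ?case by simp
next
  case (Suc n)
  let ?s = "surv (\<lambda>k. \<mu> (Suc k)) (\<lambda>k. D (Suc k)) (\<lambda>k. b (Suc k)) n"
  interpret real_distribution "\<mu> 0" using Suc.prems by (simp add: step_weights_def)
  have D[measurable]: "D 0 \<in> borel_measurable borel" and D0: "\<And>v. 0 \<le> D 0 v" and DB: "\<And>v. D 0 v \<le> B"
    using Suc.prems by (auto simp: step_weights_def)
  have s[measurable]: "?s \<in> borel_measurable borel" and s0: "\<And>x. 0 \<le> ?s x" and sB: "\<And>x. ?s x \<le> B ^ n"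
    using Suc.IH[OF step_weights_Suc[OF Suc.prems]] by auto
  have B0: "0 \<le> B" using D0 DB order_trans by blast
  have bd: "D 0 v * (indicator {..b 0} (x + v) * ?s (x + v)) \<le> B * B ^ n" for x v
  proof (rule mult_mono)
    have "indicator {..b 0} (x + v) * ?s (x + v) \<le> 1 * ?s (x + v)"
      by (rule mult_right_mono) (auto simp: s0 indicator_def)
    then show "indicator {..b 0} (x + v) * ?s (x + v) \<le> B ^ n" using sB[of "x + v"] by simp
  qed (auto simp: DB s0 B0 zero_le_power)
  have nn: "0 \<le> D 0 v * (indicator {..b 0} (x + v) * ?s (x + v))" for x v
    using D0 s0 by simp
  have "surv \<mu> D b (Suc n) \<in> borel_measurable borel"
    unfolding surv.simps by measurable
  moreover have "surv \<mu> D b (Suc n) x \<le> B ^ Suc n" for x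
    unfolding surv.simps power_Suc
    by (rule integral_le_const[OF integrable_const_bound[where B="B * B ^ n"]])
       (use bd nn in \<open>auto\<close>)
  moreover have "0 \<le> surv \<mu> D b (Suc n) x" for x
    unfolding surv.simps using nn by simp
  ultimately show ?case by blast
qed

lemma surv_measurable: "step_weights B \<mu> D \<Longrightarrow> surv \<mu> D b n \<in> borel_measurable borel"
  and surv_nonneg: "step_weights B \<mu> D \<Longrightarrow> 0 \<le> surv \<mu> D b n x"
  and surv_le: "step_weights B \<mu> D \<Longrightarrow> surv \<mu> D b n x \<le> B ^ n"
  using surv_measurable_bounds by blast+

lemma integrable_surv_step:
  assumes "step_weights B \<mu> D" "real_distribution N" and [measurable]: "E \<in> borel_measurable borel"
    and "\<And>v. 0 \<le> E v" "\<And>v. E v \<le> C"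
  shows "integrable N (\<lambda>v. E v * (indicator {..c} (x + v) * surv \<mu> D b n (x + v)))"
proof -
  interpret real_distribution N by fact
  note [measurable] = surv_measurable[OF assms(1)]
  have "0 \<le> C" using assms(4,5) order_trans by blast
  have "norm (E v * (indicator {..c} (x + v) * surv \<mu> D b n (x + v))) \<le> C * B ^ n" for v
  proof -
    have 0: "0 \<le> surv \<mu> D b n (x + v)" "surv \<mu> D b n (x + v) \<le> B ^ n"
      using assms(1) surv_nonneg surv_le by blast+
    then have "indicator {..c} (x + v) * surv \<mu> D b n (x + v) \<le> B ^ n" by (auto simp: indicator_def)
    then show ?thesis using 0 assms(4,5)[of v] \<open>0 \<le> C\<close> by (auto intro!: mult_mono simp: abs_mult)
  qed
  then show ?thesis
    by (intro integrable_const_bound[where B="C * B ^ n"]) (simp_all)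
qed

text \<open>Peeling off first steps on both sides reduces the claim to \<open>surv\<close> being at
  most 1. It allows a conditioned jump to use up time without using up a step of the untilted
  walk.\<close>

lemma surv_const_Suc_le:
  assumes "real_distribution \<mu>"
  shows "surv (\<lambda>_. \<mu>) (\<lambda>_ _. 1) (\<lambda>_. c) (Suc n) y \<le> surv (\<lambda>_. \<mu>) (\<lambda>_ _. 1) (\<lambda>_. c) n y"
proof (induction n arbitrary: y)
  case 0
  then show ?case using surv_le[OF step_weights_one, of "\<lambda>_. \<mu>"  "\<lambda>_. c" 1 y] assms by simp
next
  case (Suc n)
  have w: "step_weights 1 (\<lambda>_. \<mu>) (\<lambda>_ _. 1)" using assms by (simp add: step_weights_one)
  show ?case
    unfolding surv.simps(2)[of _ _ _ "Suc n"] surv.simps(2)[of _ _ _ n y]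
    by (intro integral_mono integrable_surv_step[OF w assms])
       (use Suc.IH in \<open>auto simp: indicator_def simp del: surv.simps\<close>)
qed

lemma surv_antimono:
  assumes "\<And>k. real_distribution (\<mu> k)" "x \<le> x'" "\<And>k. k < n \<Longrightarrow> b' k \<le> b k"
  shows "surv \<mu> (\<lambda>_ _. 1) b' n x' \<le> surv \<mu> (\<lambda>_ _. 1) b n x"
  using assms
proof (induction n arbitrary: \<mu> b b' x x')
  case (Suc n)
  let ?s' = "surv (\<lambda>k. \<mu> (Suc k)) (\<lambda>_ _. 1) (\<lambda>k. b' (Suc k)) n"
    and ?s = "surv (\<lambda>k. \<mu> (Suc k)) (\<lambda>_ _. 1) (\<lambda>k. b (Suc k)) n"
  have w: "step_weights 1 (\<lambda>k. \<mu> (Suc k)) (\<lambda>_ _. 1)" using Suc.prems by (simp add: step_weights_one)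
  have IH: "?s' (x' + v) \<le> ?s (x + v)" for v using Suc.prems by (intro Suc.IH) auto
  have nn: "0 \<le> ?s v" for v by (rule surv_nonneg[OF w])
  have "b' 0 \<le> b 0" using Suc.prems by auto
  then show ?case unfolding surv.simps
    by (intro integral_mono integrable_surv_step[OF w Suc.prems(1)])
       (use IH nn Suc.prems(2) in \<open>auto simp: indicator_def simp del: surv.simps\<close>)
qed simp

text \<open>Markov property at step \<open>n1\<close>, combined with monotonicity in the starting
  point: surviving below \<open>b'\<close> leaves the walk at most at
  \<open>b' (n1 - 1) \<le> z\<close>, from where it does at least as well as from \<open>z\<close>.
  With \<open>n1 = 0\<close> there is no last boundary value, so \<open>x\<close> itself takes its
  place.\<close>

lemma surv_split:
  assumes "\<And>k. real_distribution (\<mu> k)" "\<And>k. k < n1 \<Longrightarrow> b' k \<le> b k"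
    "n1 = 0 \<Longrightarrow> x \<le> z" "n1 > 0 \<Longrightarrow> b' (n1 - 1) \<le> z"
  shows "surv \<mu> (\<lambda>_ _. 1) b' n1 x * surv (\<lambda>k. \<mu> (n1 + k)) (\<lambda>_ _. 1) (\<lambda>k. b (n1 + k)) n2 z
     \<le> surv \<mu> (\<lambda>_ _. 1) b (n1 + n2) x"
  using assms
proof (induction n1 arbitrary: \<mu> b b' x)
  case 0
  then show ?case using surv_antimono[of \<mu> x z n2 b b] by simp
next
  case (Suc n)
  let ?S = "surv (\<lambda>k. \<mu> (Suc n + k)) (\<lambda>_ _. 1) (\<lambda>k. b (Suc n + k)) n2 z"
  let ?s' = "surv (\<lambda>k. \<mu> (Suc k)) (\<lambda>_ _. 1) (\<lambda>k. b' (Suc k)) n"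
    and ?s = "surv (\<lambda>k. \<mu> (Suc k)) (\<lambda>_ _. 1) (\<lambda>k. b (Suc k)) (n + n2)"
  have w: "step_weights 1 (\<lambda>k. \<mu> (Suc k)) (\<lambda>_ _. 1)" using Suc.prems by (simp add: step_weights_one)
  have nn: "0 \<le> ?s v" for v by (rule surv_nonneg[OF w])
  have IH: "?s' (x + v) * ?S \<le> ?s (x + v)" if "x + v \<le> b' 0" for v
  proof -
    have "?s' (x + v) * surv (\<lambda>k. \<mu> (Suc (n + k))) (\<lambda>_ _. 1) (\<lambda>k. b (Suc (n + k))) n2 z \<le> ?s (x + v)"
    proof (rule Suc.IH)
      show "x + v \<le> z" if "n = 0" using that \<open>x + v \<le> b' 0\<close> Suc.prems(4) by simp
      show "b' (Suc (n - 1)) \<le> z" if "n > 0" using that Suc.prems(4) by simp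
    qed (use Suc.prems in auto)
    then show ?thesis by simp
  qed
  have "b' 0 \<le> b 0" using Suc.prems by auto
  have "surv \<mu> (\<lambda>_ _. 1) b' (Suc n) x * ?S
      = (\<integral>v. 1 * (indicator {..b' 0} (x + v) * ?s' (x + v)) * ?S \<partial>\<mu> 0)"
    unfolding surv.simps by simp
  also have "\<dots> \<le> surv \<mu> (\<lambda>_ _. 1) b (Suc (n + n2)) x"
    unfolding surv.simps
    by (intro integral_mono integrable_mult_left integrable_surv_step[OF w Suc.prems(1)])
       (use IH nn \<open>b' 0 \<le> b 0\<close> in \<open>auto simp: indicator_def simp del: surv.simps\<close>)
  finally show ?case by simp
qed

subsection \<open>Tilting the step law\<close>

text \<open>The linear coefficient has to be exactly \<open>p\<close>, since that term is integrated
  against a centred perturbation and vanishes; \<open>C\<close> depends on \<open>p\<close> and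
  \<open>\<Theta>\<close> alone. In the induction the cubic term is absorbed by
  \<open>x \<le> \<Theta>\<close>.\<close>

lemma one_plus_power_le_quadratic:
  fixes \<Theta> :: real
  assumes "0 \<le> \<Theta>"
  obtains C where "0 \<le> C" "\<And>x. -1 \<le> x \<Longrightarrow> x \<le> \<Theta> \<Longrightarrow> (1 + x) ^ p \<le> 1 + real p * x + C * x\<^sup>2"
proof -
  have "\<exists>C\<ge>0. \<forall>x. -1 \<le> x \<and> x \<le> \<Theta> \<longrightarrow> (1 + x) ^ p \<le> 1 + real p * x + C * x\<^sup>2"
  proof (induction p)
    case 0
    then show ?case by auto
  next
    case (Suc p)
    then obtain C where C: "0 \<le> C"
      "\<And>x. -1 \<le> x \<Longrightarrow> x \<le> \<Theta> \<Longrightarrow> (1 + x) ^ p \<le> 1 + real p * x + C * x\<^sup>2"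
      by blast
    have "(1 + x) ^ Suc p \<le> 1 + real (Suc p) * x + (p + C * (1 + \<Theta>)) * x\<^sup>2"
      if x: "-1 \<le> x" "x \<le> \<Theta>" for x
    proof -
      have "(1 + x) ^ Suc p \<le> (1 + x) * (1 + real p * x + C * x\<^sup>2)"
        using C(2)[OF x] x by (auto intro: mult_left_mono)
      also have "\<dots> = 1 + real (Suc p) * x + (p + C * (1 + x)) * x\<^sup>2"
        by (simp add: algebra_simps power2_eq_square)
      also have "\<dots> \<le> 1 + real (Suc p) * x + (p + C * (1 + \<Theta>)) * x\<^sup>2"
        using x C(1) by (intro add_left_mono mult_right_mono mult_left_mono) auto
      finally show ?thesis .
    qed
    then show ?case using C(1) assms by (intro exI[of _ "p + C * (1 + \<Theta>)"]) auto
  qed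
  then show thesis using that by blast
qed

section \<open>Hoelder's inequality along the walk\<close>

text \<open>Young's inequality for the exponents \<open>p\<close> and \<open>p / (p - 1)\<close>.
  The conjugate power of \<open>g\<close> is expressed by \<open>g ^ p \<le> w ^ (p - 1)\<close>, so
  only natural powers occur; at \<open>p = 1\<close> this hypothesis reads
  \<open>g \<le> 1\<close>.\<close>

lemma young_power:
  fixes x g w :: real
  assumes "0 < p" "0 \<le> x" "0 \<le> g" "0 \<le> w" "g ^ p \<le> w ^ (p - 1)"
  shows "x * g \<le> x ^ p / p + (1 - 1 / p) * w"
proof (cases "x = 0 \<or> w = 0")
  case True
  moreover have "x * g = 0" if "w = 0" "p \<noteq> 1"
    using assms that by (auto simp: power_0_left power_le_zero_eq)
  moreover have "g \<le> 1" if "p = 1" using assms that by simp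
  moreover have "0 \<le> (1 - 1 / p) * w" using assms by (intro mult_nonneg_nonneg) auto
  ultimately show ?thesis using assms
    by (cases "p = 1") (auto simp: mult_left_le zero_le_power)
next
  case False
  then have pos: "0 < x" "0 < w" using assms by auto
  have "g = root p (g ^ p)" using assms by (simp add: real_root_power_cancel)
  also have "\<dots> \<le> root p (w ^ (p - 1))" using assms by (simp add: real_root_le_iff)
  also have "\<dots> = w powr (1 - 1 / p)"
    using assms pos by (simp add: root_powr_inverse powr_powr field_simps flip: powr_realpow)
  finally have "x * g \<le> x * w powr (1 - 1 / p)" using pos by simp
  also have "\<dots> = (x ^ p) powr (1 / p) * w powr (1 - 1 / p)"
    using assms pos by (simp add: powr_powr flip: powr_realpow)
  also have "\<dots> \<le> 1 / p * x ^ p + (1 - 1 / p) * w"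
    using assms pos by (intro Youngs_inequality_0) auto
  finally show ?thesis by simp
qed

text \<open>Hoelder's inequality raised to the power \<open>p\<close>. The hypothesis relating
  \<open>g\<close> and \<open>h\<close> has the shape of the conclusion, so that the estimate can be
  iterated along the steps of the walk.\<close>

lemma (in prob_space) holder_power:
  fixes D g h :: "'a \<Rightarrow> real"
  assumes p: "0 < p" and "0 < K" "0 < c"
    and nn: "\<And>v. 0 \<le> D v" "\<And>v. 0 \<le> g v" "\<And>v. 0 \<le> h v"
    and gh: "\<And>v. g v ^ p \<le> c * h v ^ (p - 1)"
    and int: "integrable M (\<lambda>v. D v ^ p)" "integrable M h" "integrable M (\<lambda>v. D v * g v)"
    and K: "(\<integral>v. D v ^ p \<partial>M) \<le> K"
  shows "(\<integral>v. D v * g v \<partial>M) ^ p \<le> K * c * (\<integral>v. h v \<partial>M) ^ (p - 1)"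
proof (cases "p > 1 \<and> (\<integral>v. h v \<partial>M) = 0")
  case True
  then have "AE v in M. h v = 0" using integral_nonneg_eq_0_iff_AE[of M h] int(2) nn by auto
  then have "AE v in M. D v * g v = 0"
  proof (rule AE_mp, intro AE_I2 impI)
    fix v assume "h v = 0"
    then have "g v ^ p \<le> 0" using gh[of v] True by (simp add: power_0_left)
    then show "D v * g v = 0" using nn(2)[of v] p by (auto simp: power_le_zero_eq)
  qed
  then have "(\<integral>v. D v * g v \<partial>M) = 0" by (rule integral_eq_zero_AE)
  then show ?thesis using True by (auto simp: power_0_left)
next
  case False
  \<comment> \<open>For \<open>p = 1\<close> the power \<open>V ^ (p - 1)\<close> is 1 for every
    \<open>V\<close>, so the value 1 keeps \<open>V\<close> positive even if the integral of
    \<open>h\<close> vanishes.\<close>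
  define V where "V = (if p > 1 then \<integral>v. h v \<partial>M else 1)"
  have V: "0 < V" using False nn(3) unfolding V_def by (auto simp: less_le)
  have VV: "V ^ (p - 1) = (\<integral>v. h v \<partial>M) ^ (p - 1)" unfolding V_def using p by auto
  define k where "k = root p K"
  define l where "l = root p (c * V ^ (p - 1))"
  have kl: "0 < k" "0 < l" "k ^ p = K" "l ^ p = c * V ^ (p - 1)"
    unfolding k_def l_def using assms V by (auto simp: real_root_gt_zero real_root_pow_pos)
  \<comment> \<open>Young's inequality for \<open>D\<close> and \<open>g\<close> scaled by
    \<open>k\<close> and \<open>l\<close>; the two terms on the right then integrate to at most
    \<open>1 / p\<close> and \<open>1 - 1 / p\<close>.\<close>
  have "D v * g v / (k * l) \<le> D v ^ p / (p * K) + (1 - 1 / p) * (h v / V)" for v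
  proof -
    have "(g v / l) ^ p \<le> (h v / V) ^ (p - 1)"
      using gh[of v] kl V \<open>0 < c\<close> by (simp add: power_divide field_simps)
    then have "D v / k * (g v / l) \<le> (D v / k) ^ p / p + (1 - 1 / p) * (h v / V)"
      using nn kl V by (intro young_power p) auto
    then show ?thesis using kl by (simp add: power_divide mult.commute)
  qed
  then have "(\<integral>v. D v * g v / (k * l) \<partial>M) \<le> (\<integral>v. D v ^ p / (p * K) + (1 - 1 / p) * (h v / V) \<partial>M)"
    by (intro integral_mono Bochner_Integration.integrable_add integrable_divide int integrable_mult_right)
  also have "\<dots> = (\<integral>v. D v ^ p \<partial>M) / (p * K) + (1 - 1 / p) * ((\<integral>v. h v \<partial>M) / V)"
    using int by (simp add: Bochner_Integration.integral_add)
  also have "\<dots> \<le> 1 / p + (1 - 1 / p)"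
  proof (rule add_mono)
    show "(\<integral>v. D v ^ p \<partial>M) / (p * K) \<le> 1 / p" using K \<open>0 < K\<close> p by (simp add: field_simps)
    show "(1 - 1 / p) * ((\<integral>v. h v \<partial>M) / V) \<le> 1 - 1 / p"
      using V p unfolding V_def by (cases "p = 1") auto
  qed
  finally have "(\<integral>v. D v * g v \<partial>M) \<le> k * l" using kl by (simp add: field_simps)
  then have "(\<integral>v. D v * g v \<partial>M) ^ p \<le> (k * l) ^ p"
    using nn by (intro power_mono) auto
  then show ?thesis using kl VV by (simp add: power_mult_distrib)
qed

text \<open>Hoelder's inequality is applied one step at a time, each step multiplying the bound by
  the \<open>p\<close>-th moment of its weight. In the application the product of the weights is the
  density of the modified walk.\<close>

lemma surv_power_le:
  assumes "step_weights B \<mu> D" "1 < p" "\<And>k. k < n \<Longrightarrow> 0 < K k"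
    and "\<And>k. k < n \<Longrightarrow> (\<integral>v. D k v ^ p \<partial>\<mu> k) \<le> K k"
  shows "surv \<mu> D b n x ^ p \<le> (\<Prod>k<n. K k) * surv \<mu> (\<lambda>_ _. 1) b n x ^ (p - 1)"
  using assms
proof (induction n arbitrary: \<mu> D b x K)
  case (Suc n)
  let ?q = "surv (\<lambda>k. \<mu> (Suc k)) (\<lambda>k. D (Suc k)) (\<lambda>k. b (Suc k)) n"
    and ?s = "surv (\<lambda>k. \<mu> (Suc k)) (\<lambda>_ _. 1) (\<lambda>k. b (Suc k)) n"
  have d: "real_distribution (\<mu> k)" for k using Suc.prems(1) by (simp add: step_weights_def)
  interpret real_distribution "\<mu> 0" by (rule d)
  have wq: "step_weights B (\<lambda>k. \<mu> (Suc k)) (\<lambda>k. D (Suc k))" by (rule step_weights_Suc[OF Suc.prems(1)])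
  have ws: "step_weights 1 (\<lambda>k. \<mu> (Suc k)) (\<lambda>_ _. 1)" by (rule step_weights_one[OF d])
  have D[measurable]: "D 0 \<in> borel_measurable borel" and D0: "\<And>v. 0 \<le> D 0 v" "\<And>v. D 0 v \<le> B"
    using Suc.prems by (auto simp: step_weights_def)
  have IH: "?q y ^ p \<le> (\<Prod>k<n. K (Suc k)) * ?s y ^ (p - 1)" for y
    using Suc.prems by (intro Suc.IH[OF wq]) auto
  have "surv \<mu> D b (Suc n) x ^ p \<le> K 0 * (\<Prod>k<n. K (Suc k)) * surv \<mu> (\<lambda>_ _. 1) b (Suc n) x ^ (p - 1)"
    unfolding surv.simps
  proof (rule holder_power)
    show "integrable (\<mu> 0) (\<lambda>v. D 0 v ^ p)"
      using D0 by (intro integrable_const_bound[where B="B ^ p"]) (auto intro!: power_mono)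
    show "integrable (\<mu> 0) (\<lambda>v. 1 * (indicator {..b 0} (x + v) * ?s (x + v)))"
      by (intro integrable_surv_step[OF ws d]) auto
    show "integrable (\<mu> 0) (\<lambda>v. D 0 v * (indicator {..b 0} (x + v) * ?q (x + v)))"
      using D0 by (intro integrable_surv_step[OF wq d]) auto
    show "(indicator {..b 0} (x + v) * ?q (x + v)) ^ p
      \<le> (\<Prod>k<n. K (Suc k)) * (1 * (indicator {..b 0} (x + v) * ?s (x + v))) ^ (p - 1)" for v
      using IH[of "x + v"] \<open>1 < p\<close> by (auto simp: indicator_def power_0_left)
    show "0 < (\<Prod>k<n. K (Suc k))" using Suc.prems by (intro prod_pos) auto
  qed (use Suc.prems D0 surv_nonneg[OF ws] surv_nonneg[OF wq] in auto)
  then show ?case by (simp add: prod.lessThan_Suc_shift del: prod.lessThan_Suc)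
qed simp

section \<open>The tilted density and its moments\<close>

text \<open>The density, with respect to \<open>\<mu>\<close>, of the mixture of
  \<open>\<mu>\<close> with weight \<open>1 - e\<close> and of \<open>\<mu>\<close> conditioned on
  \<open>{..-\<epsilon>}\<close> with weight \<open>e\<close>.\<close>

definition tilt :: "real measure \<Rightarrow> real \<Rightarrow> real \<Rightarrow> real \<Rightarrow> real" where
  "tilt \<mu> \<epsilon> e v = 1 - e + e / measure \<mu> {..-\<epsilon>} * indicator {..-\<epsilon>} v"

lemma tilt_measurable [measurable]: "tilt \<mu> \<epsilon> e \<in> borel_measurable borel"
  unfolding tilt_def[abs_def] by measurable

text \<open>In the application \<open>e\<close> is of the order of the mesh and the mass of
  \<open>{..-\<epsilon>}\<close> at least of that order, so \<open>\<Theta>\<close> can be chosen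
  independently of the mesh.\<close>

lemma tilt_bounds:
  assumes "0 \<le> e" "e \<le> 1" "e \<le> \<Theta> * measure \<mu> {..-\<epsilon>}" "0 < measure \<mu> {..-\<epsilon>}"
  shows "0 \<le> tilt \<mu> \<epsilon> e v" "tilt \<mu> \<epsilon> e v \<le> 1 + \<Theta>"
proof -
  have "e / measure \<mu> {..-\<epsilon>} \<le> \<Theta>" "0 \<le> e / measure \<mu> {..-\<epsilon>}"
    using assms by (simp_all add: field_simps)
  moreover from this have "0 \<le> \<Theta>" by linarith
  ultimately show "0 \<le> tilt \<mu> \<epsilon> e v" "tilt \<mu> \<epsilon> e v \<le> 1 + \<Theta>"
    using assms unfolding tilt_def by (auto simp: indicator_def)
qed

text \<open>The density is \<open>1 + \<theta> (I - a)\<close> with \<open>a\<close> the mass of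
  \<open>{..-\<epsilon>}\<close>, \<open>I\<close> its indicator and
  \<open>\<theta> = e / a\<close>. As \<open>I - a\<close> has mean 0 and variance at most
  \<open>a\<close>, the quadratic bound leaves \<open>1 + C \<theta>^2 a\<close>, that is
  \<open>1 + C e^2 / a\<close>.\<close>

lemma tilt_moment:
  assumes "real_distribution \<mu>" "0 < measure \<mu> {..-\<epsilon>}" "0 \<le> e" "e \<le> 1" "e \<le> \<Theta> * measure \<mu> {..-\<epsilon>}"
    and C: "0 \<le> C" "\<And>x. -1 \<le> x \<Longrightarrow> x \<le> \<Theta> \<Longrightarrow> (1 + x) ^ p \<le> 1 + real p * x + C * x\<^sup>2"
  shows "(\<integral>v. tilt \<mu> \<epsilon> e v ^ p \<partial>\<mu>) \<le> exp (C * e\<^sup>2 / measure \<mu> {..-\<epsilon>})"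
proof -
  interpret real_distribution \<mu> by fact
  let ?a = "prob {..-\<epsilon>}" and ?I = "indicator {..-\<epsilon>} :: real \<Rightarrow> real"
  define \<theta> where "\<theta> = e / ?a"
  have \<theta>: "0 \<le> \<theta>" "\<theta> \<le> \<Theta>" "\<theta> * ?a = e" using assms by (auto simp: \<theta>_def field_simps)
  have t: "tilt \<mu> \<epsilon> e v = 1 + \<theta> * (?I v - ?a)" for v
    using \<theta> unfolding tilt_def \<theta>_def[symmetric] by (simp add: algebra_simps)
  have I: "integrable \<mu> ?I" by (simp add: emeasure_eq_measure)
  \<comment> \<open>The last bracket is \<open>(I - a)^2\<close>, expanded with
    \<open>I^2 = I\<close>.\<close>
  have le: "tilt \<mu> \<epsilon> e v ^ p \<le> 1 + (real p * \<theta> * (?I v - ?a) + C * \<theta>\<^sup>2 * (?I v - 2 * ?a * ?I v + ?a\<^sup>2))" for v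
  proof -
    have ineq: "\<theta> * (?I v - ?a) \<le> \<Theta>"
      using \<theta> assms(2) mult_left_mono[OF _ \<theta>(1), of "?I v - ?a" 1]
      by (auto simp: indicator_def split: if_splits)
    have "-1 \<le> \<theta> * (?I v - ?a)"
      using \<theta> assms by (auto simp: indicator_def algebra_simps)
    from C(2)[OF this ineq] show ?thesis unfolding t
      by (cases "v \<le> - \<epsilon>") (simp_all add: power2_eq_square algebra_simps)
  qed
  have "integrable \<mu> (\<lambda>v. tilt \<mu> \<epsilon> e v ^ p)"
    using tilt_bounds[OF assms(3-5,2)]
    by (intro integrable_const_bound[where B="(1 + \<Theta>) ^ p"]) (auto intro!: power_mono)
  then have "(\<integral>v. tilt \<mu> \<epsilon> e v ^ p \<partial>\<mu>)
      \<le> (\<integral>v. 1 + (real p * \<theta> * (?I v - ?a) + C * \<theta>\<^sup>2 * (?I v - 2 * ?a * ?I v + ?a\<^sup>2)) \<partial>\<mu>)"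
    using I le by (intro integral_mono) auto
  also have "\<dots> = 1 + (real p * \<theta> * (?a - ?a) + C * \<theta>\<^sup>2 * (?a - 2 * ?a * ?a + ?a\<^sup>2))"
    using I prob_space by simp
  also have "\<dots> = 1 + C * \<theta>\<^sup>2 * (?a - ?a\<^sup>2)" by (simp add: power2_eq_square)
  also have "\<dots> \<le> 1 + C * \<theta>\<^sup>2 * ?a" using C(1) by (intro add_left_mono mult_left_mono) auto
  also have "C * \<theta>\<^sup>2 * ?a = C * e\<^sup>2 / ?a" by (simp add: \<theta>_def power2_eq_square)
  also have "1 + C * e\<^sup>2 / ?a \<le> exp (C * e\<^sup>2 / ?a)" by (rule exp_ge_add_one_self)
  finally show ?thesis .
qed

text \<open>
  The tilted step is, with probability \<open>e k\<close>, a jump conditioned to be at most \<open>-\<epsilon>\<close>, and otherwise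
  an ordinary step. Only ordinary steps are used up by the untilted walk, which is started at \<open>y\<close>;
  hence the gap \<open>y - x\<close> between the two walks grows by at least \<open>\<epsilon>\<close> at each conditioned jump, and
  \<open>exp (F k - (y - x))\<close> is a supermartingale.
\<close>

lemma surv_tilt_ge:
  assumes \<mu>: "real_distribution \<mu>" and \<epsilon>: "0 < \<epsilon>" and a: "0 < measure \<mu> {..-\<epsilon>}"
    and e: "\<And>k. 0 \<le> e k" "\<And>k. e k \<le> 1" "\<And>k. e k \<le> \<Theta> * measure \<mu> {..-\<epsilon>}"
    and eF: "\<And>k. k < n \<Longrightarrow> F (Suc k) - F k \<le> e k * (1 - exp (-\<epsilon>))"
    and b: "\<And>k. k < n \<Longrightarrow> c - F (Suc k) \<le> b k" and "y \<le> c"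
  shows "surv (\<lambda>_. \<mu>) (\<lambda>_ _. 1) (\<lambda>_. c) n y * (1 - exp (F 0 - (y - x)))
      \<le> surv (\<lambda>_. \<mu>) (\<lambda>k. tilt \<mu> \<epsilon> (e k)) b n x"
  using e eF b \<open>y \<le> c\<close>
proof (induction n arbitrary: e F b x y)
  case (Suc n)
  let ?s = "surv (\<lambda>_. \<mu>) (\<lambda>_ _. 1) (\<lambda>_. c)" and ?I = "indicator {..-\<epsilon>} :: real \<Rightarrow> real"
    and ?q = "surv (\<lambda>_. \<mu>) (\<lambda>k. tilt \<mu> \<epsilon> (e (Suc k))) (\<lambda>k. b (Suc k)) n"
  interpret real_distribution \<mu> by fact
  let ?a = "prob {..-\<epsilon>}"
  \<comment> \<open>\<open>L\<close> and \<open>L'\<close> are the factors available after an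
    ordinary step, which keeps the gap \<open>y - x\<close>, and after a conditioned jump, which
    widens it by at least \<open>\<epsilon>\<close>.\<close>
  define L where "L = 1 - exp (F 1 - (y - x))"
  define L' where "L' = 1 - exp (F 1 - (y - x) - \<epsilon>)"
  have ws: "step_weights 1 (\<lambda>_. \<mu>) (\<lambda>_ _. 1)" by (rule step_weights_one[OF \<mu>])
  have wq: "step_weights (1 + \<Theta>) (\<lambda>_. \<mu>) (\<lambda>k. tilt \<mu> \<epsilon> (e (Suc k)))"
    unfolding step_weights_def using \<mu> tilt_bounds[OF Suc.prems(1-3) a] by simp
  have s0: "0 \<le> ?s m v" for m v by (rule surv_nonneg[OF ws])
  have q0: "0 \<le> ?q v" for v by (rule surv_nonneg[OF wq])
  have IH: "?s n y' * (1 - exp (F 1 - (y' - x'))) \<le> ?q x'" if "y' \<le> c" for x' y'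
    using Suc.IH[of "\<lambda>k. e (Suc k)" "\<lambda>k. F (Suc k)" "\<lambda>k. b (Suc k)" y' x'] Suc.prems that by simp
  have b0: "c - F 1 \<le> b 0" using Suc.prems(5)[of 0] by simp
  have qi: "integrable \<mu> (\<lambda>v. 1 * (indicator {..b 0} (x + v) * ?q (x + v)))"
    "integrable \<mu> (\<lambda>v. ?I v * (indicator {..b 0} (x + v) * ?q (x + v)))"
    by (rule integrable_surv_step[OF wq \<mu>, where C=1]; simp)+
  have si: "integrable \<mu> (\<lambda>v. 1 * (indicator {..c} (y + v) * ?s n (y + v)))"
    by (rule integrable_surv_step[OF ws \<mu>]) auto
  have sum: "surv (\<lambda>_. \<mu>) (\<lambda>k. tilt \<mu> \<epsilon> (e k)) b (Suc n) x
    = (1 - e 0) * (\<integral>v. 1 * (indicator {..b 0} (x + v) * ?q (x + v)) \<partial>\<mu>)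
      + e 0 / ?a * (\<integral>v. ?I v * (indicator {..b 0} (x + v) * ?q (x + v)) \<partial>\<mu>)"
  proof -
    have "surv (\<lambda>_. \<mu>) (\<lambda>k. tilt \<mu> \<epsilon> (e k)) b (Suc n) x
      = (\<integral>v. (1 - e 0) * (1 * (indicator {..b 0} (x + v) * ?q (x + v)))
          + e 0 / ?a * (?I v * (indicator {..b 0} (x + v) * ?q (x + v))) \<partial>\<mu>)"
      unfolding surv.simps by (intro Bochner_Integration.integral_cong refl) (simp add: tilt_def[of _ _ "e 0"] algebra_simps)
    then show ?thesis
      using qi by (subst (asm) Bochner_Integration.integral_add) simp_all
  qed
  \<comment> \<open>Both walks take the same step \<open>v\<close>. If \<open>L\<close> is positive
    then \<open>F 1 < y - x\<close>, so the modified walk is below its boundary whenever the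
    untilted one is below \<open>c\<close>.\<close>
  have 1: "L * ?s (Suc n) y \<le> (\<integral>v. 1 * (indicator {..b 0} (x + v) * ?q (x + v)) \<partial>\<mu>)"
  proof -
    have "L * (1 * (indicator {..c} (y + v) * ?s n (y + v))) \<le> 1 * (indicator {..b 0} (x + v) * ?q (x + v))" for v
    proof (cases "L \<le> 0 \<or> c < y + v")
      case True
      then show ?thesis using s0 q0 by (auto simp: indicator_def mult_le_0_iff intro: order_trans[of _ 0])
    next
      case False
      then have "F 1 < y - x" unfolding L_def by auto
      then have "x + v \<le> b 0" using False b0 by linarith
      moreover have "?s n (y + v) * L \<le> ?q (x + v)" using IH[of "y + v" "x + v"] False unfolding L_def by simp
      ultimately show ?thesis using False by (simp add: mult.commute)
    qed
    then have "(\<integral>v. L * (1 * (indicator {..c} (y + v) * ?s n (y + v))) \<partial>\<mu>)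
        \<le> (\<integral>v. 1 * (indicator {..b 0} (x + v) * ?q (x + v)) \<partial>\<mu>)"
      by (intro integral_mono qi integrable_mult_right si)
    then show ?thesis by simp
  qed
  \<comment> \<open>Here only the modified walk moves; the untilted one stays at
    \<open>y \<le> c\<close>, and its survival over \<open>n + 1\<close> steps is weakened to
    \<open>n\<close> steps.\<close>
  have 2: "L' * ?s (Suc n) y * ?a \<le> (\<integral>v. ?I v * (indicator {..b 0} (x + v) * ?q (x + v)) \<partial>\<mu>)"
  proof -
    have le: "?s (Suc n) y \<le> ?s n y" by (rule surv_const_Suc_le[OF \<mu>])
    have "L' * ?s (Suc n) y * ?I v \<le> ?I v * (indicator {..b 0} (x + v) * ?q (x + v))" for v
    proof (cases "L' \<le> 0 \<or> -\<epsilon> < v")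
      case True
      then show ?thesis using s0[of "Suc n" y] q0 by (auto simp: indicator_def mult_le_0_iff intro: order_trans[of _ 0] simp del: surv.simps)
    next
      case False
      then have "F 1 - \<epsilon> < y - x" unfolding L'_def by auto
      then have "x + v \<le> b 0" using False b0 Suc.prems(6) by linarith
      have "L' * ?s (Suc n) y \<le> L' * ?s n y" using le False by (intro mult_left_mono) auto
      also have "L' * ?s n y \<le> (1 - exp (F 1 - (y - (x + v)))) * ?s n y"
        unfolding L'_def using False s0 by (intro mult_right_mono) auto
      also have "\<dots> \<le> ?q (x + v)" using IH[OF Suc.prems(6), of "x + v"] by (simp only: mult.commute)
      finally show ?thesis using False \<open>x + v \<le> b 0\<close> by (simp del: surv.simps)
    qed
    then have "(\<integral>v. L' * ?s (Suc n) y * ?I v \<partial>\<mu>)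
        \<le> (\<integral>v. ?I v * (indicator {..b 0} (x + v) * ?q (x + v)) \<partial>\<mu>)"
      by (intro integral_mono qi integrable_mult_right) (simp add: emeasure_eq_measure)
    then show ?thesis by (simp del: surv.simps)
  qed
  \<comment> \<open>The supermartingale inequality: \<open>1 - u \<le> exp (- u)\<close> together
    with the assumed growth of \<open>F\<close> bounds the expectation of
    \<open>exp (F - gap)\<close> after one step by its present value.\<close>
  have "exp (F 1 - F 0) * (1 - e 0 * (1 - exp (-\<epsilon>))) \<le> exp (F 1 - F 0) * exp (- (e 0 * (1 - exp (-\<epsilon>))))"
    using exp_ge_add_one_self[of "- (e 0 * (1 - exp (-\<epsilon>)))"] by (intro mult_left_mono) auto
  also have "\<dots> \<le> 1" using Suc.prems(4)[of 0] by (simp flip: exp_add)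
  finally have "exp (F 0 - (y - x)) * (exp (F 1 - F 0) * (1 - e 0 * (1 - exp (-\<epsilon>)))) \<le> exp (F 0 - (y - x)) * 1"
    by (intro mult_left_mono) auto
  then have "exp (F 1 - (y - x)) * (1 - e 0 * (1 - exp (-\<epsilon>))) \<le> exp (F 0 - (y - x))"
    unfolding mult.assoc[symmetric] by (simp flip: exp_add add: algebra_simps)
  moreover have L': "L' = 1 - exp (F 1 - (y - x)) * exp (-\<epsilon>)"
    unfolding L'_def by (simp flip: exp_add)
  ultimately have "1 - exp (F 0 - (y - x)) \<le> (1 - e 0) * L + e 0 * L'"
    unfolding L_def L' by (simp add: algebra_simps)
  then have "?s (Suc n) y * (1 - exp (F 0 - (y - x))) \<le> ?s (Suc n) y * ((1 - e 0) * L + e 0 * L')"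
    using s0 by (intro mult_left_mono) auto
  also have "\<dots> = (1 - e 0) * (L * ?s (Suc n) y) + e 0 / ?a * (L' * ?s (Suc n) y * ?a)"
    using a by (simp add: algebra_simps del: surv.simps)
  also have "\<dots> \<le> surv (\<lambda>_. \<mu>) (\<lambda>k. tilt \<mu> \<epsilon> (e k)) b (Suc n) x"
    unfolding sum using Suc.prems(1,2) a by (intro add_mono mult_left_mono 1 2) auto
  finally show ?case .
qed simp

text \<open>The tilted walk survives by the supermartingale estimate, and Hoelder's inequality
  returns to the untilted step law at the price of the moments. The powers \<open>p\<close> and
  \<open>p - 1\<close> are the source of a loss in the exponent, which disappears as
  \<open>p\<close> grows.\<close>

lemma surv_boundary_ge:
  assumes \<mu>: "real_distribution \<mu>" and \<epsilon>: "0 < \<epsilon>" and a: "0 < measure \<mu> {..-\<epsilon>}" and p: "1 < p"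
    and C: "0 \<le> C" "\<And>x. -1 \<le> x \<Longrightarrow> x \<le> \<Theta> \<Longrightarrow> (1 + x) ^ p \<le> 1 + real p * x + C * x\<^sup>2"
    and e: "\<And>k. 0 \<le> e k" "\<And>k. e k \<le> 1" "\<And>k. e k \<le> \<Theta> * measure \<mu> {..-\<epsilon>}"
    and eF: "\<And>k. k < n \<Longrightarrow> F (Suc k) - F k \<le> e k * (1 - exp (-\<epsilon>))"
    and b: "\<And>k. k < n \<Longrightarrow> c - F (Suc k) \<le> b k" and "y \<le> c" and "F 0 \<le> y - x"
  shows "exp (- (C * (\<Sum>k<n. (e k)\<^sup>2) / measure \<mu> {..-\<epsilon>}))
       * (surv (\<lambda>_. \<mu>) (\<lambda>_ _. 1) (\<lambda>_. c) n y * (1 - exp (F 0 - (y - x)))) ^ p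
      \<le> surv (\<lambda>_. \<mu>) (\<lambda>_ _. 1) b n x ^ (p - 1)"
proof -
  let ?s = "surv (\<lambda>_. \<mu>) (\<lambda>_ _. 1) (\<lambda>_. c) n y" and ?S = "C * (\<Sum>k<n. (e k)\<^sup>2) / measure \<mu> {..-\<epsilon>}"
  have wq: "step_weights (1 + \<Theta>) (\<lambda>_. \<mu>) (\<lambda>k. tilt \<mu> \<epsilon> (e k))"
    unfolding step_weights_def using \<mu> tilt_bounds[OF e a] by simp
  have "(?s * (1 - exp (F 0 - (y - x)))) ^ p \<le> surv (\<lambda>_. \<mu>) (\<lambda>k. tilt \<mu> \<epsilon> (e k)) b n x ^ p"
    using surv_nonneg[OF step_weights_one[OF \<mu>]] \<open>F 0 \<le> y - x\<close>
    by (intro power_mono surv_tilt_ge[where \<Theta>=\<Theta>] assms) (auto intro!: mult_nonneg_nonneg)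
  also have "\<dots> \<le> (\<Prod>k<n. exp (C * (e k)\<^sup>2 / measure \<mu> {..-\<epsilon>})) * surv (\<lambda>_. \<mu>) (\<lambda>_ _. 1) b n x ^ (p - 1)"
    by (rule surv_power_le[OF wq p]) (auto intro!: tilt_moment[where \<Theta>=\<Theta>] assms)
  also have "(\<Prod>k<n. exp (C * (e k)\<^sup>2 / measure \<mu> {..-\<epsilon>})) = exp ?S"
    by (simp add: sum_distrib_left sum_divide_distrib flip: exp_sum)
  finally have "exp (- ?S) * (?s * (1 - exp (F 0 - (y - x)))) ^ p
      \<le> exp (- ?S) * (exp ?S * surv (\<lambda>_. \<mu>) (\<lambda>_ _. 1) b n x ^ (p - 1))"
    by (intro mult_left_mono) auto
  then show ?thesis by (simp flip: mult.assoc exp_add)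
qed

subsection \<open>The rate of negative jumps\<close>

text \<open>One quarter of the fourth central difference. It annihilates polynomials of degree up to
  three, whereas a second difference would retain a constant from the Gaussian term.\<close>

definition fourth_diff :: "real \<Rightarrow> (real \<Rightarrow> complex) \<Rightarrow> real \<Rightarrow> complex" where
  "fourth_diff s g u =
     g (u - 2 * s) / 4 - g (u - s) + 3 / 2 * g u - g (u + s) + g (u + 2 * s) / 4"

text \<open>With \<open>z = iexp (s * x)\<close> and its inverse \<open>z'\<close>, the coefficients
  are those of \<open>(1 - (z + z') / 2)^2\<close>. The resulting weight is nonnegative, so it can
  serve as a density.\<close>

lemma fourth_diff_iexp:
  "fourth_diff s (\<lambda>u. iexp (u * x)) u = iexp (u * x) * of_real ((1 - cos (s * x))\<^sup>2)"
proof -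
  define z where "z = iexp (s * x)"
  define z' where "z' = iexp (- (s * x))"
  have zz: "z * z' = 1" unfolding z_def z'_def by (simp flip: exp_add)
  have c: "of_real (cos (s * x)) = (z + z') / 2"
    unfolding z_def z'_def cos_of_real[symmetric] cos_exp_eq by simp
  have z1: "iexp (s * x) = z" "iexp (- (s * x)) = z'" by (simp_all add: z_def z'_def)
  have z2: "iexp (2 * (s * x)) = z\<^sup>2" "iexp (- (2 * (s * x))) = z'\<^sup>2"
    unfolding z_def z'_def power2_eq_square exp_add[symmetric] by (simp_all add: algebra_simps)
  have e: "iexp ((u + v) * x) = iexp (u * x) * iexp (v * x)" for v
    by (simp add: algebra_simps exp_add)
  have "fourth_diff s (\<lambda>u. iexp (u * x)) u
      = iexp (u * x) * (z'\<^sup>2 / 4 - z' + 3 / 2 - z + z\<^sup>2 / 4)"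
    using e[of "-2 * s"] e[of "-s"] e[of s] e[of "2 * s"] z1 z2
    unfolding fourth_diff_def by (simp add: algebra_simps)
  also have "z'\<^sup>2 / 4 - z' + 3 / 2 - z + z\<^sup>2 / 4 = (1 - (z + z') / 2)\<^sup>2"
    using zz by (simp add: power2_eq_square field_simps)
  finally show ?thesis by (simp add: c)
qed

text \<open>The coefficients of the difference add up to 0, which removes the constant.\<close>

lemma fourth_diff_affine: "fourth_diff s (\<lambda>u. (g u - 1) / c) u = fourth_diff s g u / c"
  unfolding fourth_diff_def by (simp add: add_divide_distrib diff_divide_distrib mult.commute)

lemma fourth_diff_integral:
  assumes "\<And>u. integrable N (g u)"
  shows "fourth_diff s (\<lambda>u. \<integral>x. g u x \<partial>N) u = (\<integral>x. fourth_diff s (\<lambda>u. g u x) u \<partial>N)"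
    "integrable N (\<lambda>x. fourth_diff s (\<lambda>u. g u x) u)"
  unfolding fourth_diff_def using assms by simp_all

text \<open>Taylor's formula gives the bound \<open>(u x)^2 / 2\<close> on \<open>[-1, 1]\<close>,
  and outside the integrand is at most 2 in norm; both are dominated by a multiple of
  \<open>min 1 (x^2)\<close>.\<close>

lemma levy_integrand_integrable:
  assumes "levy_measure \<nu>"
  shows "integrable \<nu> (\<lambda>x. iexp (u * x) - 1 - (if \<bar>x\<bar> \<le> 1 then \<i> * of_real (u * x) else 0))"
    (is "integrable \<nu> ?G")
proof (rule integrableI_bounded)
  have [measurable_cong, simp]: "sets \<nu> = sets borel" using assms by (simp add: levy_measure_def)
  show "?G \<in> borel_measurable \<nu>" by measurable
  have "norm (?G x) \<le> (2 + u\<^sup>2) * min 1 (x\<^sup>2)" for x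
  proof (cases "\<bar>x\<bar> \<le> 1")
    case True
    have "norm (?G x) \<le> (u * x)\<^sup>2 / 2"
      using iexp_approx1[of "u * x" 1] True by (simp add: algebra_simps power2_eq_square abs_mult numeral_2_eq_2)
    also have "\<dots> \<le> (2 + u\<^sup>2) * x\<^sup>2" by (simp add: power_mult_distrib algebra_simps)
    finally show ?thesis using True abs_square_le_1[of x] by simp
  next
    case False
    have "norm (?G x) \<le> norm (iexp (u * x)) + norm (1::complex)"
      using False norm_triangle_ineq4[of "iexp (u * x)" 1] by simp
    also have "\<dots> \<le> (2 + u\<^sup>2) * 1" by (simp del: of_real_mult)
    finally show ?thesis using False abs_square_le_1[of x] by (simp add: min_def)
  qed
  then have "ennreal (norm (?G x)) \<le> ennreal (2 + u\<^sup>2) * ennreal (min 1 (x\<^sup>2))" for x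
    by (subst ennreal_mult[symmetric]) (auto intro!: ennreal_leI simp del: of_real_mult)
  then have "(\<integral>\<^sup>+x. norm (?G x) \<partial>\<nu>) \<le> (\<integral>\<^sup>+x. ennreal (2 + u\<^sup>2) * ennreal (min 1 (x\<^sup>2)) \<partial>\<nu>)"
    by (intro nn_integral_mono)
  also have "\<dots> = ennreal (2 + u\<^sup>2) * (\<integral>\<^sup>+x. ennreal (min 1 (x\<^sup>2)) \<partial>\<nu>)"
    by (rule nn_integral_cmult) measurable
  also have "\<dots> < \<infinity>" using assms by (simp add: levy_measure_def ennreal_mult_less_top)
  finally show "(\<integral>\<^sup>+x. norm (?G x) \<partial>\<nu>) < \<infinity>" .
qed

text \<open>The drift, the Gaussian term and, inside the integral, the constant and the compensator
  are polynomials in \<open>u\<close> of degree at most two and cancel.\<close>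

lemma fourth_diff_levy_exponent:
  assumes "levy_measure \<nu>"
  shows "fourth_diff s (levy_exponent \<sigma>2 b \<nu>) u = (\<integral>x. iexp (u * x) * of_real ((1 - cos (s * x))\<^sup>2) \<partial>\<nu>)"
    "integrable \<nu> (\<lambda>x. iexp (u * x) * of_real ((1 - cos (s * x))\<^sup>2))"
proof -
  define G where "G u x = iexp (u * x) - 1 - (if \<bar>x\<bar> \<le> 1 then \<i> * of_real (u * x) else 0)" for u x :: real
  have G: "integrable \<nu> (G u)" for u using levy_integrand_integrable[OF assms] unfolding G_def .
  have "fourth_diff s (\<lambda>u. G u x) u = fourth_diff s (\<lambda>u. iexp (u * x)) u" for x
    unfolding fourth_diff_def G_def by (auto simp: algebra_simps add_divide_distrib diff_divide_distrib)
  note eq = this[unfolded fourth_diff_iexp]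
  have "levy_exponent \<sigma>2 b \<nu> = (\<lambda>u. (\<i> * of_real (b * u) - of_real (\<sigma>2 / 2 * u\<^sup>2)) + (\<integral>x. G u x \<partial>\<nu>))"
    unfolding levy_exponent_def G_def by simp
  then have "fourth_diff s (levy_exponent \<sigma>2 b \<nu>) u = fourth_diff s (\<lambda>u. \<integral>x. G u x \<partial>\<nu>) u"
    unfolding fourth_diff_def by (simp add: power2_eq_square field_simps) 
  then show "fourth_diff s (levy_exponent \<sigma>2 b \<nu>) u = (\<integral>x. iexp (u * x) * of_real ((1 - cos (s * x))\<^sup>2) \<partial>\<nu>)"
    using fourth_diff_integral(1)[where g=G, OF G] by (simp add: eq)
  show "integrable \<nu> (\<lambda>x. iexp (u * x) * of_real ((1 - cos (s * x))\<^sup>2))"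
    using fourth_diff_integral(2)[where g=G, OF G, of s u] unfolding eq .
qed

lemma fourth_diff_char:
  assumes "real_distribution \<mu>"
  shows "fourth_diff s (char \<mu>) u = (\<integral>x. iexp (u * x) * of_real ((1 - cos (s * x))\<^sup>2) \<partial>\<mu>)"
proof -
  interpret real_distribution \<mu> by fact
  have "char \<mu> = (\<lambda>u. \<integral>x. iexp (u * x) \<partial>\<mu>)" by (rule ext) (simp add: char_def)
  then show ?thesis
    using fourth_diff_integral(1)[where g="\<lambda>u x. iexp (u * x)" and N=\<mu>]
    by (simp only: fourth_diff_iexp) (simp add: integrable_iexp del: of_real_mult)
qed

lemma exp_difference_quotient_tendsto:
  fixes z :: complex
  assumes "h \<longlonglongrightarrow> 0" "\<And>m::nat. h m > (0::real)"
  shows "(\<lambda>m. (exp (of_real (h m) * z) - 1) / of_real (h m)) \<longlonglongrightarrow> z"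
proof -
  have "((\<lambda>x. exp (x * z)) has_field_derivative z) (at 0)"
    by (auto intro!: derivative_eq_intros)
  then have "((\<lambda>x. (exp (x * z) - 1) / x) \<longlongrightarrow> z) (at 0)" by (simp add: DERIV_def)
  moreover have "filterlim (\<lambda>m. complex_of_real (h m)) (at 0) sequentially"
    using assms by (auto simp: filterlim_at tendsto_of_real_iff[of _ 0, simplified] less_imp_neq[THEN not_sym])
  ultimately show ?thesis by (rule filterlim_compose)
qed

text \<open>The weight vanishes where \<open>s x\<close> is a multiple of \<open>2 pi\<close>, so a
  single \<open>s\<close> might miss all negative jumps. For \<open>s = 1 / (n + 1)\<close> with
  \<open>n > |x|\<close> one has \<open>0 < |s x| \<le> 1\<close>; hence countably many values of
  \<open>s\<close> together detect every \<open>x < 0\<close>.\<close>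

lemma levy_jump_weight_pos:
  assumes "levy_measure \<nu>" "emeasure \<nu> {..<0} > 0"
  obtains s where "\<not> (AE x in \<nu>. x < 0 \<longrightarrow> (1 - cos (s * x))\<^sup>2 = 0)"
proof -
  have [measurable_cong, simp]: "sets \<nu> = sets borel" using assms by (simp add: levy_measure_def)
  have "\<exists>n. \<not> (AE x in \<nu>. x < 0 \<longrightarrow> (1 - cos (1 / real (Suc n) * x))\<^sup>2 = 0)"
  proof (rule ccontr)
    assume "\<not> ?thesis"
    then have "AE x in \<nu>. \<forall>n. x < 0 \<longrightarrow> (1 - cos (1 / real (Suc n) * x))\<^sup>2 = 0"
      unfolding AE_all_countable by blast
    then have "AE x in \<nu>. \<not> x < 0"
    proof (rule AE_mp, intro AE_I2 impI notI)
      fix x :: real assume *: "\<forall>n. x < 0 \<longrightarrow> (1 - cos (1 / real (Suc n) * x))\<^sup>2 = 0" "x < 0"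
      obtain n where n: "\<bar>x\<bar> < real n" using reals_Archimedean2 by blast
      let ?y = "1 / real (Suc n) * \<bar>x\<bar>"
      have "cos ?y = 1" using * cos_abs_real[of "1 / real (Suc n) * x"] by (simp add: abs_mult)
      moreover have "0 < ?y" "?y \<le> 1" using n *(2) by (auto simp: field_simps)
      moreover from this have "?y \<le> pi" using pi_gt3 by linarith
      ultimately show False
        using cos_monotone_0_pi[of 0 ?y] by simp
    qed
    then have "emeasure \<nu> {x \<in> space \<nu>. x < 0} = 0"
      using sets_eq_imp_space_eq[of \<nu> borel] by (subst (asm) AE_iff_measurable) auto
    moreover have "{x \<in> space \<nu>. x < 0} = {..<0}" using sets_eq_imp_space_eq[of \<nu> borel] by auto
    ultimately show False using assms by simp
  qed
  then show thesis using that by blast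
qed

text \<open>Applied both to the Levy measure, which the weight makes finite, and to the laws of
  small increments; the formula for the characteristic function is what the continuity theorem asks
  for.\<close>

lemma weighted_distribution:
  fixes w :: "real \<Rightarrow> real"
  assumes \<kappa>: "\<kappa> = density N (\<lambda>x. ennreal (w x / W))" and W: "W = (\<integral>x. w x \<partial>N)" "0 < W"
    and [measurable_cong]: "sets N = sets borel"
    and [measurable]: "w \<in> borel_measurable borel" and w: "\<And>x. 0 \<le> w x" "integrable N w"
  shows "real_distribution \<kappa>"
    "char \<kappa> u = (\<integral>x. iexp (u * x) * of_real (w x) \<partial>N) / of_real W"
    "A \<in> sets borel \<Longrightarrow> measure \<kappa> A = (\<integral>x. indicator A x * w x \<partial>N) / W"
proof -
  have nn: "0 \<le> w x / W" for x using w W by simp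
  have "(\<integral>\<^sup>+x. ennreal (w x / W) \<partial>N) = ennreal (\<integral>x. w x / W \<partial>N)"
    using w nn by (intro nn_integral_eq_integral) auto
  also have "\<dots> = 1" using W by simp
  finally have "emeasure \<kappa> (space \<kappa>) = 1" unfolding \<kappa> by (simp add: emeasure_density cong: nn_integral_cong)
  then have "prob_space \<kappa>" by (rule prob_spaceI)
  then show "real_distribution \<kappa>"
    unfolding real_distribution_def real_distribution_axioms_def by (simp add: \<kappa> assms(4))
  have "char \<kappa> u = (\<integral>x. (w x / W) *\<^sub>R iexp (u * x) \<partial>N)"
    unfolding char_def \<kappa> using nn by (intro integral_density) auto
  also have "\<dots> = (\<integral>x. iexp (u * x) * of_real (w x) / of_real W \<partial>N)"
    by (simp add: scaleR_conv_of_real mult.commute)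
  also have "\<dots> = (\<integral>x. iexp (u * x) * of_real (w x) \<partial>N) / of_real W"
    by (rule integral_divide_zero)
  finally show "char \<kappa> u = (\<integral>x. iexp (u * x) * of_real (w x) \<partial>N) / of_real W" .
  assume A[measurable]: "A \<in> sets borel"
  interpret \<kappa>: prob_space \<kappa> by fact
  have "measure \<kappa> A = (\<integral>x. indicator A x \<partial>\<kappa>)" using A by (simp add: \<kappa> assms(4))
  also have "\<dots> = (\<integral>x. (w x / W) *\<^sub>R indicator A x \<partial>N)"
    unfolding \<kappa> using nn by (intro integral_density) auto
  also have "\<dots> = (\<integral>x. indicator A x * w x / W \<partial>N)" by (simp add: mult.commute)
  finally show "measure \<kappa> A = (\<integral>x. indicator A x * w x \<partial>N) / W" by simp
qed

text \<open>
  The measures \<open>(1 - cos (s x))\<^sup>2 \<mu>\<^sub>h(dx) / h\<close>, where \<open>\<mu>\<^sub>h\<close> is the law of \<open>X h\<close>, converge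
  weakly as \<open>h\<close> tends to 0: the characteristic functions are fourth differences of the
  one of \<open>\<mu>\<^sub>h\<close>, which cancel the drift and the Gaussian part.
\<close>

lemma levy_negative_jump_rate:
  assumes "levy_process M X" "has_levy_triplet M X \<sigma>2 b \<nu>" "emeasure \<nu> {..<0} > 0"
  obtains \<epsilon> c where "0 < \<epsilon>" "0 < c"
    "\<And>h. h \<longlonglongrightarrow> 0 \<Longrightarrow> (\<And>m::nat. 0 < h m) \<Longrightarrow>
       \<forall>\<^sub>F m in sequentially. c * h m \<le> measure (distr M borel (X (h m))) {..-\<epsilon>}"
proof -
  interpret levy_process M X by fact
  have \<nu>: "levy_measure \<nu>" using assms(2) by (simp add: has_levy_triplet_def)
  then have [measurable_cong]: "sets \<nu> = sets borel" and sp: "space \<nu> = UNIV"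
    using sets_eq_imp_space_eq[of \<nu> borel] by (auto simp: levy_measure_def)
  let ?\<psi> = "levy_exponent \<sigma>2 b \<nu>"
  obtain s where s: "\<not> (AE x in \<nu>. x < 0 \<longrightarrow> (1 - cos (s * x))\<^sup>2 = 0)"
    using levy_jump_weight_pos[OF \<nu> assms(3)] .
  define w where "w x = (1 - cos (s * x))\<^sup>2" for x
  have [measurable]: "w \<in> borel_measurable borel" unfolding w_def[abs_def] by measurable
  have wb: "0 \<le> w x" "w x \<le> 4" for x
  proof -
    have "(1 - cos (s * x))\<^sup>2 \<le> 2\<^sup>2" by (intro power_mono) auto
    then show "0 \<le> w x" "w x \<le> 4" by (auto simp: w_def)
  qed
  have \<psi>: "fourth_diff s ?\<psi> u = (\<integral>x. iexp (u * x) * of_real (w x) \<partial>\<nu>)" for u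
    using fourth_diff_levy_exponent[OF \<nu>] by (simp add: w_def)
  have wint: "integrable \<nu> w"
    using fourth_diff_levy_exponent(2)[OF \<nu>, where u=0 and s=s, THEN integrable_Re] by (simp add: w_def[abs_def])
  have negint: "integrable \<nu> (\<lambda>x. indicator {..<0} x * w x)"
    using wint by (rule Bochner_Integration.integrable_bound) (auto simp: indicator_def)
  have neg: "0 < (\<integral>x. indicator {..<0} x * w x \<partial>\<nu>)"
  proof (rule ccontr)
    assume "\<not> ?thesis"
    moreover have "0 \<le> (\<integral>x. indicator {..<0} x * w x \<partial>\<nu>)" using wb by (intro Bochner_Integration.integral_nonneg) auto
    ultimately have "AE x in \<nu>. indicator {..<0} x * w x = 0"
      using negint wb by (subst integral_nonneg_eq_0_iff_AE[symmetric]) auto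
    then have "AE x in \<nu>. x < 0 \<longrightarrow> (1 - cos (s * x))\<^sup>2 = 0" by eventually_elim (auto simp: w_def)
    then show False using s by simp
  qed
  define W where "W = (\<integral>x. w x \<partial>\<nu>)"
  have W: "0 < W"
  proof -
    have "(\<integral>x. indicator {..<0} x * w x \<partial>\<nu>) \<le> W" unfolding W_def
      using wint negint wb by (intro integral_mono) (auto simp: indicator_def)
    then show ?thesis using neg by linarith
  qed
  define \<kappa> where "\<kappa> = density \<nu> (\<lambda>x. ennreal (w x / W))"
  note \<kappa> = weighted_distribution[OF \<kappa>_def W_def W \<open>sets \<nu> = sets borel\<close> \<open>w \<in> borel_measurable borel\<close> wb(1) wint]
  interpret \<kappa>: real_distribution \<kappa> by (rule \<kappa>)
  have "0 < measure \<kappa> {..<0}" using neg W by (simp add: \<kappa>(3))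
  then have "\<forall>\<^sub>F x in at_left 0. 0 < cdf \<kappa> x"
    using \<kappa>.cdf_at_left[of 0] order_tendstoD(1) by blast
  then obtain r where r: "r < 0" "\<And>x. r < x \<Longrightarrow> x < 0 \<Longrightarrow> 0 < cdf \<kappa> x"
    unfolding eventually_at_left_field by auto
  \<comment> \<open>A distribution function has countably many jumps, so the interval contains a
    continuity point; \<open>-\<epsilon>\<close> has to be one for weak convergence to apply
    there.\<close>
  have "\<not> {r<..<0} \<subseteq> {x. measure \<kappa> {x} > 0}"
    using \<kappa>.countable_atoms countable_subset uncountable_open_interval[of r 0] r(1) by blast
  then obtain x where x: "r < x" "x < 0" "measure \<kappa> {x} = 0"
    using zero_less_measure_iff by fastforce
  define \<epsilon> where "\<epsilon> = - x"
  have \<epsilon>: "0 < \<epsilon>" "isCont (cdf \<kappa>) (-\<epsilon>)" "0 < cdf \<kappa> (-\<epsilon>)"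
    using x r by (auto simp: \<epsilon>_def \<kappa>.isCont_cdf)
  \<comment> \<open>A factor 2 is given up in the limit and a factor 4 in the bound
    \<open>w x \<le> 4\<close>, whence the 8.\<close>
  define c where "c = W * cdf \<kappa> (-\<epsilon>) / 8"
  have "\<forall>\<^sub>F m in sequentially. c * h m \<le> measure (distr M borel (X (h m))) {..-\<epsilon>}"
    if h: "h \<longlonglongrightarrow> 0" "\<And>m::nat. 0 < h m" for h
  proof -
    define \<mu> where "\<mu> m = distr M borel (X (h m))" for m
    have \<mu>: "real_distribution (\<mu> m)" for m
      unfolding \<mu>_def using h random_variable_at by (intro real_distribution_distr) (simp add: less_imp_le)
    have char: "char (\<mu> m) u = exp (of_real (h m) * ?\<psi> u)" for m u
      using assms(2) h(2)[of m] random_variable_at[of "h m"]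
      by (simp add: \<mu>_def char_def integral_distr has_levy_triplet_def less_imp_le)
    define V where "V m = (\<integral>x. w x \<partial>\<mu> m)" for m
    have wi: "integrable (\<mu> m) w" for m
    proof -
      interpret \<mu>: real_distribution "\<mu> m" by (rule \<mu>)
      show ?thesis using wb by (intro \<mu>.integrable_const_bound[where B=4]) auto
    qed
    \<comment> \<open>Fourth differences of \<open>(char - 1) / h\<close>, which tends pointwise to
      the Levy exponent.\<close>
    have lim: "(\<lambda>m. (\<integral>x. iexp (u * x) * of_real (w x) \<partial>\<mu> m) / of_real (h m))
      \<longlonglongrightarrow> (\<integral>x. iexp (u * x) * of_real (w x) \<partial>\<nu>)" for u
    proof -
      have "(\<integral>x. iexp (u * x) * of_real (w x) \<partial>\<mu> m) / of_real (h m)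
        = fourth_diff s (\<lambda>v. (exp (of_real (h m) * ?\<psi> v) - 1) / of_real (h m)) u" for m
        unfolding fourth_diff_affine char[symmetric] w_def[symmetric] fourth_diff_char[OF \<mu>] ..
      moreover have "(\<lambda>m. fourth_diff s (\<lambda>v. (exp (of_real (h m) * ?\<psi> v) - 1) / of_real (h m)) u)
        \<longlonglongrightarrow> fourth_diff s ?\<psi> u"
        unfolding fourth_diff_def by (intro tendsto_intros exp_difference_quotient_tendsto h) auto
      ultimately show ?thesis by (simp add: \<psi>)
    qed
    have Vlim: "(\<lambda>m. V m / h m) \<longlonglongrightarrow> W"
      using tendsto_Re[OF lim[of 0]] by (simp add: V_def W_def)
    then have "\<forall>\<^sub>F m in sequentially. 0 < V m / h m" using W order_tendstoD(1) by blast
    then obtain N where N: "\<And>m. m \<ge> N \<Longrightarrow> 0 < V m"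
      unfolding eventually_sequentially using h(2) by (auto simp: zero_less_divide_iff dest: less_asym)
    \<comment> \<open>\<open>V m\<close> is known to be positive for large \<open>m\<close> only;
      shifting by \<open>N\<close> makes every \<open>\<kappa>' m\<close> a probability
      measure.\<close>
    define \<kappa>' where "\<kappa>' m = density (\<mu> (m + N)) (\<lambda>x. ennreal (w x / V (m + N)))" for m
    have sets_\<mu>: "sets (\<mu> m) = sets borel" for m by (simp add: \<mu>_def)
    note \<kappa>' = weighted_distribution[OF \<kappa>'_def V_def N[OF le_add2] sets_\<mu> \<open>w \<in> borel_measurable borel\<close> wb(1) wi]
    have "(\<lambda>m. char (\<kappa>' m) u) \<longlonglongrightarrow> char \<kappa> u" for u
    proof -
      have "(\<lambda>m. ((\<integral>x. iexp (u * x) * of_real (w x) \<partial>\<mu> m) / of_real (h m)) / of_real (V m / h m))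
        \<longlonglongrightarrow> (\<integral>x. iexp (u * x) * of_real (w x) \<partial>\<nu>) / of_real W"
        using W by (intro tendsto_divide lim tendsto_of_real Vlim) auto
      from LIMSEQ_ignore_initial_segment[OF this, of N] show ?thesis
        using h(2) less_imp_neq[OF h(2)] by (simp add: \<kappa>'(2) \<kappa>(2))
    qed
    then have "weak_conv_m \<kappa>' \<kappa>" by (intro levy_continuity \<kappa>'(1) \<kappa>(1))
    then have "(\<lambda>m. cdf (\<kappa>' m) (-\<epsilon>)) \<longlonglongrightarrow> cdf \<kappa> (-\<epsilon>)"
      using \<epsilon>(2) by (simp add: weak_conv_m_def weak_conv_def)
    then have "(\<lambda>m. V (m + N) / h (m + N) * cdf (\<kappa>' m) (-\<epsilon>)) \<longlonglongrightarrow> W * cdf \<kappa> (-\<epsilon>)"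
      by (intro tendsto_mult LIMSEQ_ignore_initial_segment[OF Vlim])
    moreover have "W * cdf \<kappa> (-\<epsilon>) / 2 < W * cdf \<kappa> (-\<epsilon>)" using W \<epsilon>(3) by simp
    ultimately have "\<forall>\<^sub>F m in sequentially. W * cdf \<kappa> (-\<epsilon>) / 2 < V (m + N) / h (m + N) * cdf (\<kappa>' m) (-\<epsilon>)"
      using order_tendstoD(1) by blast
    then have "\<forall>\<^sub>F m in sequentially. c * h (m + N) \<le> measure (\<mu> (m + N)) {..-\<epsilon>}"
    proof eventually_elim
      case (elim m)
      interpret \<mu>: real_distribution "\<mu> (m + N)" by (rule \<mu>)
      have "(\<integral>x. indicator {..-\<epsilon>} x * w x \<partial>\<mu> (m + N)) \<le> (\<integral>x. 4 * indicator {..-\<epsilon>} x \<partial>\<mu> (m + N))"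
        using wb by (intro integral_mono \<mu>.integrable_const_bound[where B=4]) (auto simp: indicator_def)
      then have "V (m + N) * cdf (\<kappa>' m) (-\<epsilon>) \<le> 4 * measure (\<mu> (m + N)) {..-\<epsilon>}"
        using N[of "m + N"] by (simp add: cdf_def \<kappa>'(3))
      then show ?case using elim h(2)[of "m + N"] by (simp add: c_def field_simps)
    qed
    then show ?thesis
      unfolding \<mu>_def
        eventually_sequentially_seg[of "\<lambda>m. c * h m \<le> measure (distr M borel (X (h m))) {..-\<epsilon>}"] .
  qed
  moreover have "0 < c" unfolding c_def using W \<epsilon> by simp
  ultimately show thesis using that \<epsilon>(1) by blast
qed

subsection \<open>Discretisation of a Levy process\<close>

lemma surv_cong:
  assumes "\<And>k. k < n \<Longrightarrow> \<mu> k = \<mu>' k"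
  shows "surv \<mu> D b n x = surv \<mu>' D b n x"
  using assms
proof (induction n arbitrary: \<mu> \<mu>' D b x)
  case (Suc n)
  then have "surv (\<lambda>k. \<mu> (Suc k)) (\<lambda>k. D (Suc k)) (\<lambda>k. b (Suc k)) n v
      = surv (\<lambda>k. \<mu>' (Suc k)) (\<lambda>k. D (Suc k)) (\<lambda>k. b (Suc k)) n v" for v
    by (intro Suc.IH) auto
  then show ?case using Suc.prems[of 0] by simp
qed simp

lemma (in prob_space) indep_vars_shift:
  assumes "indep_vars (\<lambda>_. N) \<xi> (Suc ` I)"
  shows "indep_vars (\<lambda>_. N) (\<lambda>i. \<xi> (Suc i)) I"
proof -
  let ?F = "\<lambda>i. {\<xi> i -` A \<inter> space M |A. A \<in> sets N}"
  have F: "indep_sets ?F (Suc ` I)" and rv: "\<And>i. i \<in> I \<Longrightarrow> random_variable N (\<xi> (Suc i))"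
    using assms unfolding indep_vars_def2 by simp_all
  have "indep_sets (\<lambda>i. ?F (Suc i)) I"
  proof (rule indep_setsI)
    show "?F (Suc i) \<subseteq> events" if "i \<in> I" for i
      using rv[OF that] by (auto intro: measurable_sets)
  next
    fix A J assume J: "J \<noteq> {}" "J \<subseteq> I" "finite J" "\<forall>j\<in>J. A j \<in> ?F (Suc j)"
    have "prob (\<Inter>j\<in>Suc ` J. A (j - 1)) = (\<Prod>j\<in>Suc ` J. prob (A (j - 1)))"
      by (rule indep_setsD[OF F]) (use J in \<open>simp_all add: image_mono\<close>)
    then show "prob (\<Inter>j\<in>J. A j) = (\<Prod>j\<in>J. prob (A j))"
      by (simp add: prod.reindex)
  qed
  then show ?thesis using rv unfolding indep_vars_def2 by simp
qed

text \<open>\<open>surv\<close> integrates over the first step. That step is independent of the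
  remaining ones, so Fubini's theorem applies to the joint law, and the slice over a first step
  \<open>v\<close> is the same kind of event for the remaining steps started at
  \<open>x + v\<close>.\<close>

lemma (in prob_space) prob_random_walk_below:
  fixes \<xi> :: "nat \<Rightarrow> 'a \<Rightarrow> real"
  assumes "indep_vars (\<lambda>_. borel) \<xi> {..<n}" and "\<And>i. random_variable borel (\<xi> i)"
  shows "prob {\<omega> \<in> space M. \<forall>i<n. x + (\<Sum>j\<le>i. \<xi> j \<omega>) \<le> b i} = surv (\<lambda>i. distr M borel (\<xi> i)) (\<lambda>_ _. 1) b n x"
  using assms
proof (induction n arbitrary: \<xi> b x)
  case 0
  then show ?case by (simp add: prob_space)
next
  case (Suc n)
  note [measurable] = Suc.prems(2)
  let ?B = "Suc ` {..<n}"
  \<comment> \<open>The first step and the others are kept as elements of product spaces, the form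
    in which independence of disjoint blocks of variables is available.\<close>
  define V where "V \<omega> = restrict (\<lambda>i. \<xi> i \<omega>) {0}" for \<omega>
  define Z where "Z \<omega> = restrict (\<lambda>i. \<xi> i \<omega>) ?B" for \<omega>
  let ?PV = "PiM {0::nat} (\<lambda>_. borel :: real measure)" and ?PZ = "PiM ?B (\<lambda>_. borel :: real measure)"
  have "indep_var ?PV V ?PZ Z"
    unfolding V_def[abs_def] Z_def[abs_def] using Suc.prems(1) by (intro indep_var_restrict) auto
  then have V[measurable]: "random_variable ?PV V" and Z[measurable]: "random_variable ?PZ Z"
    and joint: "distr M ?PV V \<Otimes>\<^sub>M distr M ?PZ Z = distr M (?PV \<Otimes>\<^sub>M ?PZ) (\<lambda>\<omega>. (V \<omega>, Z \<omega>))"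
    unfolding indep_var_distribution_eq by auto
  interpret Z: prob_space "distr M ?PZ Z" by (rule prob_space_distr) fact
  define E where "E = {p \<in> space (?PV \<Otimes>\<^sub>M ?PZ). x + fst p 0 \<le> b 0 \<and>
    (\<forall>i<n. x + fst p 0 + (\<Sum>j\<le>i. snd p (Suc j)) \<le> b (Suc i))}"
  have E[measurable]: "E \<in> sets (?PV \<Otimes>\<^sub>M ?PZ)"
  proof -
    have [measurable]: "(\<lambda>p. fst p 0) \<in> borel_measurable (?PV \<Otimes>\<^sub>M ?PZ)"
      by (rule measurable_compose[OF measurable_fst]) (rule measurable_component_singleton, simp)
    have *: "(\<lambda>p. \<Sum>j\<le>i. snd p (Suc j)) \<in> borel_measurable (?PV \<Otimes>\<^sub>M ?PZ)" if "i < n" for i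
      using that by (intro borel_measurable_sum measurable_compose[OF measurable_snd] measurable_component_singleton) auto
    have "{p \<in> space (?PV \<Otimes>\<^sub>M ?PZ). x + fst p 0 \<le> b 0} \<in> sets (?PV \<Otimes>\<^sub>M ?PZ)" (is "?E1 \<in> _")
      by measurable
    moreover have "{p \<in> space (?PV \<Otimes>\<^sub>M ?PZ). \<forall>i\<in>{..<n}. x + fst p 0 + (\<Sum>j\<le>i. snd p (Suc j)) \<le> b (Suc i)}
        \<in> sets (?PV \<Otimes>\<^sub>M ?PZ)" (is "?E2 \<in> _")
    proof (rule sets.sets_Collect_finite_All)
      fix i assume "i \<in> {..<n}"
      then have [measurable]: "(\<lambda>p. \<Sum>j\<le>i. snd p (Suc j)) \<in> borel_measurable (?PV \<Otimes>\<^sub>M ?PZ)"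
        by (intro *) simp
      show "{p \<in> space (?PV \<Otimes>\<^sub>M ?PZ). x + fst p 0 + (\<Sum>j\<le>i. snd p (Suc j)) \<le> b (Suc i)}
        \<in> sets (?PV \<Otimes>\<^sub>M ?PZ)" by measurable
    qed simp
    moreover have "E = ?E1 \<inter> ?E2" by (intro set_eqI) (simp add: E_def Ball_def conj_ac cong: conj_cong)
    ultimately show ?thesis by (simp only: sets.Int)
  qed
  have memE: "(v, Z \<omega>) \<in> E \<longleftrightarrow> x + v 0 \<le> b 0 \<and> (\<forall>i<n. x + v 0 + (\<Sum>j\<le>i. \<xi> (Suc j) \<omega>) \<le> b (Suc i))"
    if "v \<in> space ?PV" "\<omega> \<in> space M" for v \<omega>
  proof -
    have "(\<Sum>j\<le>i. Z \<omega> (Suc j)) = (\<Sum>j\<le>i. \<xi> (Suc j) \<omega>)" if "i < n" for i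
      using that unfolding Z_def by (intro sum.cong) auto
    then have "(\<forall>i<n. x + v 0 + (\<Sum>j\<le>i. Z \<omega> (Suc j)) \<le> b (Suc i))
        \<longleftrightarrow> (\<forall>i<n. x + v 0 + (\<Sum>j\<le>i. \<xi> (Suc j) \<omega>) \<le> b (Suc i))"
      by simp
    moreover have "(v, Z \<omega>) \<in> space (?PV \<Otimes>\<^sub>M ?PZ)"
      using that(1) measurable_space[OF Z that(2)] unfolding space_pair_measure by (rule SigmaI)
    ultimately show ?thesis unfolding E_def by simp
  qed
  define q where "q v = surv (\<lambda>i. distr M borel (\<xi> (Suc i))) (\<lambda>_ _. 1) (\<lambda>i. b (Suc i)) n v" for v
  have d: "real_distribution (distr M borel (\<xi> i))" for i using Suc.prems(2) by simp
  have ind: "indep_vars (\<lambda>_. borel) (\<lambda>i. \<xi> (Suc i)) {..<n}"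
  proof -
    have "indep_vars (\<lambda>_. borel) \<xi> ?B" by (rule indep_vars_subset[OF Suc.prems(1)]) auto
    then show ?thesis by (rule indep_vars_shift)
  qed
  have slice: "emeasure (distr M ?PZ Z) (Pair v -` E)
      = ennreal (indicator {..b 0} (x + v 0) * q (x + v 0))" if "v \<in> space ?PV" for v
  proof -
    have "emeasure (distr M ?PZ Z) (Pair v -` E) = emeasure M (Z -` (Pair v -` E) \<inter> space M)"
      by (rule emeasure_distr) (use E in \<open>auto intro: sets_Pair1\<close>)
    also have "Z -` (Pair v -` E) \<inter> space M = (if x + v 0 \<le> b 0
      then {\<omega> \<in> space M. \<forall>i<n. (x + v 0) + (\<Sum>j\<le>i. \<xi> (Suc j) \<omega>) \<le> b (Suc i)} else {})"
      by (rule set_eqI) (use memE[OF that] in \<open>simp split: if_split\<close>, meson)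
    finally show ?thesis
      using Suc.IH[of "\<lambda>i. \<xi> (Suc i)" "x + v 0" "\<lambda>i. b (Suc i)", OF ind Suc.prems(2)]
      by (simp add: q_def emeasure_eq_measure)
  qed
  have qm[measurable]: "q \<in> borel_measurable borel"
    unfolding q_def[abs_def] by (rule surv_measurable[OF step_weights_one[OF d]])
  have q0: "0 \<le> q v" for v unfolding q_def by (rule surv_nonneg[OF step_weights_one[OF d]])
  have ev: "{\<omega> \<in> space M. \<forall>i<Suc n. x + (\<Sum>j\<le>i. \<xi> j \<omega>) \<le> b i}
      = (\<lambda>\<omega>. (V \<omega>, Z \<omega>)) -` E \<inter> space M"
  proof -
    have "(\<forall>i<Suc n. x + (\<Sum>j\<le>i. \<xi> j \<omega>) \<le> b i) \<longleftrightarrow> (V \<omega>, Z \<omega>) \<in> E" if "\<omega> \<in> space M" for \<omega>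
      using memE[OF measurable_space[OF V that] that]
      unfolding All_less_Suc2 by (simp add: V_def sum.atMost_Suc_shift add.assoc del: sum.atMost_Suc)
    then show ?thesis by blast
  qed
  have "emeasure M {\<omega> \<in> space M. \<forall>i<Suc n. x + (\<Sum>j\<le>i. \<xi> j \<omega>) \<le> b i}
      = emeasure (distr M (?PV \<Otimes>\<^sub>M ?PZ) (\<lambda>\<omega>. (V \<omega>, Z \<omega>))) E"
    unfolding ev by (rule emeasure_distr[symmetric]) auto
  also have "\<dots> = (\<integral>\<^sup>+v. emeasure (distr M ?PZ Z) (Pair v -` E) \<partial>distr M ?PV V)"
    unfolding joint[symmetric] by (rule Z.emeasure_pair_measure_alt) (simp cong: sets_pair_measure_cong)
  also have "\<dots> = (\<integral>\<^sup>+v. ennreal (indicator {..b 0} (x + v 0) * q (x + v 0)) \<partial>distr M ?PV V)"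
    by (rule nn_integral_cong) (simp add: slice)
  also have "\<dots> = (\<integral>\<^sup>+\<omega>. ennreal (indicator {..b 0} (x + \<xi> 0 \<omega>) * q (x + \<xi> 0 \<omega>)) \<partial>M)"
    by (subst nn_integral_distr) (auto simp: V_def intro!: measurable_compose[OF measurable_component_singleton])
  also have "\<dots> = (\<integral>\<^sup>+v. ennreal (1 * (indicator {..b 0} (x + v) * q (x + v))) \<partial>distr M borel (\<xi> 0))"
    by (subst nn_integral_distr) auto
  also have "\<dots> = ennreal (\<integral>v. 1 * (indicator {..b 0} (x + v) * q (x + v)) \<partial>distr M borel (\<xi> 0))"
    unfolding q_def using q0[unfolded q_def]
    by (intro nn_integral_eq_integral integrable_surv_step[OF step_weights_one[OF d] d]) auto
  also have "\<dots> = ennreal (surv (\<lambda>i. distr M borel (\<xi> i)) (\<lambda>_ _. 1) b (Suc n) x)" by (simp add: q_def)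
  finally show ?case
    using surv_nonneg[OF step_weights_one[OF d]] by (simp add: emeasure_eq_measure del: surv.simps)
qed

context levy_process
begin

definition law :: "real \<Rightarrow> real measure" where
  "law h = distr M borel (X h)"

lemma real_distribution_law: "0 \<le> h \<Longrightarrow> real_distribution (law h)"
  unfolding law_def using random_variable_at by simp

text \<open>Stationarity and independence make the increments over the grid a random walk; its sums
  telescope to \<open>X - X 0\<close>, and \<open>X 0\<close> vanishes almost surely.\<close>

lemma prob_grid_below:
  assumes \<tau>: "\<tau> 0 = 0" "\<And>i. \<tau> i < \<tau> (Suc i)"
  shows "prob {\<omega> \<in> space M. \<forall>i<n. X (\<tau> (Suc i)) \<omega> \<le> b i}
    = surv (\<lambda>i. law (\<tau> (Suc i) - \<tau> i)) (\<lambda>_ _. 1) b n 0"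
proof -
  have \<tau>0: "0 \<le> \<tau> i" for i
    using lift_Suc_mono_le[of \<tau> 0 i] \<tau> by (simp add: less_imp_le)
  note [measurable] = random_variable_at[OF \<tau>0]
  define \<xi> where "\<xi> i \<omega> = X (\<tau> (Suc i)) \<omega> - X (\<tau> i) \<omega>" for i \<omega>
  have [measurable]: "random_variable borel (\<xi> i)" for i unfolding \<xi>_def[abs_def] by measurable
  have law: "distr M borel (\<xi> i) = law (\<tau> (Suc i) - \<tau> i)" for i
    unfolding \<xi>_def[abs_def] law_def using \<tau>0 \<tau> by (intro stationary_increments) (auto simp: less_imp_le)
  have "(\<Sum>j\<le>i. \<xi> j \<omega>) = X (\<tau> (Suc i)) \<omega> - X 0 \<omega>" for i \<omega>
    using sum_lessThan_telescope[of "\<lambda>i. X (\<tau> i) \<omega>" "Suc i"]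
    by (simp only: \<xi>_def lessThan_Suc_atMost \<tau>)
  note sum = this
  have "prob {\<omega> \<in> space M. \<forall>i<n. X (\<tau> (Suc i)) \<omega> \<le> b i}
      = prob {\<omega> \<in> space M. \<forall>i<n. 0 + (\<Sum>j\<le>i. \<xi> j \<omega>) \<le> b i}"
  proof (rule measure_eq_AE)
    show "AE \<omega> in M. (\<omega> \<in> {\<omega> \<in> space M. \<forall>i<n. X (\<tau> (Suc i)) \<omega> \<le> b i})
        = (\<omega> \<in> {\<omega> \<in> space M. \<forall>i<n. 0 + (\<Sum>j\<le>i. \<xi> j \<omega>) \<le> b i})"
      using starts_at_0 by eventually_elim (simp only: sum mem_Collect_eq diff_zero add_0)
  qed measurable
  also have "\<dots> = surv (\<lambda>i. distr M borel (\<xi> i)) (\<lambda>_ _. 1) b n 0"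
    unfolding \<xi>_def by (intro prob_random_walk_below independent_increments) (auto simp: \<tau>)
  finally show ?thesis by (simp add: law)
qed

section \<open>From finite grids to continuous time\<close>

lemma prob_below_grid_le:
  assumes "finite G" "G \<subseteq> {0..T}"
  shows "prob_below M X g T \<le> prob {\<omega> \<in> space M. \<forall>t\<in>G. X t \<omega> \<le> g t}"
proof -
  let ?H = "{\<omega> \<in> space M. \<forall>t\<in>G. X t \<omega> \<le> g t}"
  have H: "?H \<in> sets M"
  proof (rule sets.sets_Collect_finite_All[OF _ assms(1)])
    fix t assume "t \<in> G"
    then have [measurable]: "X t \<in> borel_measurable M" using assms(2) random_variable_at by auto
    show "{\<omega> \<in> space M. X t \<omega> \<le> g t} \<in> sets M" by measurable
  qed
  interpret C: finite_measure "completion M"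
    by (rule finite_measureI) (simp add: emeasure_space_1)
  have "prob_below M X g T \<le> measure (completion M) ?H"
    unfolding prob_below_def using H assms(2) by (intro C.finite_measure_mono) auto
  then show ?thesis using H by simp
qed

text \<open>If \<open>X t > g t\<close> at some \<open>t < T\<close>, right-continuity makes this
  hold on an interval to the right of \<open>t\<close>, which contains a grid point. Nothing similar
  holds at \<open>t = T\<close>, so \<open>T\<close> must be a grid point itself.\<close>

lemma below_grid_limit:
  assumes g: "\<And>t. 0 \<le> t \<Longrightarrow> t < T \<Longrightarrow> continuous (at_right t) g"
    and G: "\<And>m. finite (G m)" "\<And>m. G m \<subseteq> {0..T}" "incseq G" "T \<in> (\<Union>m. G m)"
    and dense: "\<And>t e. 0 \<le> t \<Longrightarrow> t < T \<Longrightarrow> 0 < e \<Longrightarrow> \<exists>s\<in>(\<Union>m. G m). t < s \<and> s < t + e"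
  shows "{\<omega> \<in> space M. \<forall>t\<in>{0..T}. X t \<omega> \<le> g t} \<in> sets (completion M)"
    and "(\<lambda>m. prob {\<omega> \<in> space M. \<forall>t\<in>G m. X t \<omega> \<le> g t}) \<longlonglongrightarrow> prob_below M X g T"
proof -
  let ?E = "{\<omega> \<in> space M. \<forall>t\<in>{0..T}. X t \<omega> \<le> g t}"
  define H where "H m = {\<omega> \<in> space M. \<forall>t\<in>G m. X t \<omega> \<le> g t}" for m
  have H: "H m \<in> sets M" for m
    unfolding H_def
  proof (rule sets.sets_Collect_finite_All[OF _ G(1)])
    fix t assume "t \<in> G m"
    then have [measurable]: "X t \<in> borel_measurable M" using G(2)[of m] random_variable_at by auto
    show "{\<omega> \<in> space M. X t \<omega> \<le> g t} \<in> sets M" by measurable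
  qed
  then have IH: "(\<Inter>m. H m) \<in> sets M" by auto
  obtain N where N: "{\<omega> \<in> space M. \<not> cadlag (\<lambda>t. X t \<omega>)} \<subseteq> N" "N \<in> null_sets M"
    using cadlag_paths by (auto elim!: AE_E simp: null_sets_def)
  have E_sub: "?E \<subseteq> (\<Inter>m. H m)" using G(2) unfolding H_def by blast
  have sub_E: "(\<Inter>m. H m) - N \<subseteq> ?E"
  proof
    fix \<omega> assume "\<omega> \<in> (\<Inter>m. H m) - N"
    then have \<omega>: "\<omega> \<in> space M" "cadlag (\<lambda>t. X t \<omega>)" "\<And>t m. t \<in> G m \<Longrightarrow> X t \<omega> \<le> g t"
      using N(1) unfolding H_def by auto
    have "X t \<omega> \<le> g t" if t: "t \<in> {0..T}" for t
    proof (cases "t = T")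
      case True
      then show ?thesis using \<omega>(3) G(4) by auto
    next
      case False
      then have t: "0 \<le> t" "t < T" using that by auto
      show ?thesis
      proof (rule ccontr)
        assume "\<not> ?thesis"
        moreover have "((\<lambda>s. X s \<omega> - g s) \<longlongrightarrow> X t \<omega> - g t) (at_right t)"
          using \<omega>(2) g[OF t] t(1) unfolding cadlag_def continuous_within by (intro tendsto_diff) auto
        ultimately have "\<forall>\<^sub>F s in at_right t. 0 < X s \<omega> - g s"
          by (intro order_tendstoD(1)) auto
        then obtain u where u: "t < u" "\<And>s. t < s \<Longrightarrow> s < u \<Longrightarrow> 0 < X s \<omega> - g s"
          unfolding eventually_at_right_field by auto
        obtain s where "s \<in> (\<Union>m. G m)" "t < s" "s < t + (u - t)"
          using dense[OF t, of "u - t"] u(1) by auto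
        then show False using u(2)[of s] \<omega>(3)[of s] by auto
      qed
    qed
    then show "\<omega> \<in> ?E" using \<omega>(1) by auto
  qed
  \<comment> \<open>Paths that are not cadlag are the only source of a difference between the event
    and the countable intersection; they lie in a null set, hence the completion.\<close>
  have null: "(\<Inter>m. H m) - ?E \<in> null_sets (completion M)"
    unfolding null_sets_completion_iff2 using N(2) sub_E by blast
  have eq: "?E = (\<Inter>m. H m) - ((\<Inter>m. H m) - ?E)" using E_sub by blast
  show "?E \<in> sets (completion M)"
    by (subst eq) (intro sets.Diff null_setsD2[OF null] sets_completionI_sets IH)
  have "prob_below M X g T = measure (completion M) (\<Inter>m. H m)"
    unfolding prob_below_def by (subst eq) (intro measure_Diff_null_set null sets_completionI_sets IH)
  also have "\<dots> = prob (\<Inter>m. H m)" using IH by simp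
  finally have "prob_below M X g T = prob (\<Inter>m. H m)" .
  moreover have "(\<lambda>m. prob (H m)) \<longlonglongrightarrow> prob (\<Inter>m. H m)"
    using H \<open>incseq G\<close> unfolding incseq_def H_def
    by (intro finite_Lim_measure_decseq) (auto simp: decseq_def, blast)
  ultimately show "(\<lambda>m. prob {\<omega> \<in> space M. \<forall>t\<in>G m. X t \<omega> \<le> g t}) \<longlonglongrightarrow> prob_below M X g T"
    by (simp add: H_def)
qed

end

section \<open>Dyadic grids with two mesh sizes\<close>

lemma ball_image_lessThan: "(\<forall>t\<in>h ` {..<n::nat}. P t) \<longleftrightarrow> (\<forall>i<n. P (h i))"
  by auto

lemma dyadic_between:
  fixes t e L :: real
  assumes "0 \<le> t" "t < L" "0 < e"
  obtains m k :: nat where "k < 2 ^ m" "t < L * real (Suc k) / 2 ^ m" "L * real (Suc k) / 2 ^ m < t + e"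
proof -
  have L: "0 < L" using assms by simp
  \<comment> \<open>\<open>d\<close> is less than \<open>e\<close> and at most \<open>L - t\<close>,
    so a mesh below \<open>d\<close> keeps the next grid point both close to \<open>t\<close> and
    inside \<open>[0, L]\<close>.\<close>
  define d where "d = min (e / 2) (L - t)"
  have d: "0 < d" "d < e" "t + d \<le> L" using assms by (auto simp: d_def)
  obtain m where m: "(1 / 2) ^ m < d / L" using real_arch_pow_inv[of "d / L" "1 / 2"] d L by auto
  define x where "x = t * 2 ^ m / L"
  define k where "k = nat \<lfloor>x\<rfloor>"
  have x0: "0 \<le> x" using assms L by (simp add: x_def)
  have k: "real k \<le> x" "x < real k + 1" using x0 by (auto simp: k_def)
  have t: "t = L * x / 2 ^ m" using L by (simp add: x_def)
  have d1: "L / 2 ^ m < d" using m L by (simp add: field_simps power_divide)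
  have up: "t < L * real (Suc k) / 2 ^ m" using k L unfolding t by (simp add: divide_strict_right_mono)
  have "L * real (Suc k) / 2 ^ m \<le> L * (x + 1) / 2 ^ m" using k L by (intro divide_right_mono mult_left_mono) auto
  also have "\<dots> = t + L / 2 ^ m" by (simp add: t algebra_simps add_divide_distrib)
  finally have le: "L * real (Suc k) / 2 ^ m \<le> t + L / 2 ^ m" .
  then have "L * real (Suc k) / 2 ^ m < L * 1" using d d1 by simp
  then have "L * real (Suc k) < L * 2 ^ m" by (simp add: divide_less_eq del: of_nat_Suc)
  then have "real (Suc k) < 2 ^ m" using L by (simp only: mult_less_cancel_left_pos)
  then have "k < 2 ^ m" by (metis Suc_lessD of_nat_less_iff of_nat_numeral of_nat_power)
  then show thesis using that up le d1 d by force
qed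

text \<open>Separate meshes for \<open>[0, r]\<close> and \<open>[r, r + T]\<close> make
  \<open>r\<close> and \<open>r + T\<close> grid points whatever their ratio, and each phase a
  homogeneous walk of \<open>2 ^ m\<close> steps. Powers of two make the grids nested.\<close>

definition two_phase_grid :: "real \<Rightarrow> real \<Rightarrow> nat \<Rightarrow> nat \<Rightarrow> real" where
  "two_phase_grid r T m i =
     (if i \<le> 2 ^ m then r * real i / 2 ^ m else r + T * (real i - 2 ^ m) / 2 ^ m)"

lemma two_phase_grid_step:
  "two_phase_grid r T m (Suc i) - two_phase_grid r T m i = (if i < 2 ^ m then r / 2 ^ m else T / 2 ^ m)"
proof -
  consider "i < 2 ^ m" | "i = 2 ^ m" | "2 ^ m < i" by linarith
  then show ?thesis
    by cases (auto simp: two_phase_grid_def field_simps)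
qed

lemma two_phase_grid_second:
  "two_phase_grid r T m (2 ^ m + k) = r + T * real k / 2 ^ m"
  by (simp add: two_phase_grid_def)

lemma two_phase_grid_range:
  assumes "0 < r" "0 < T" "i \<le> 2 * 2 ^ m"
  shows "0 \<le> two_phase_grid r T m i" "two_phase_grid r T m i \<le> r + T"
proof -
  have i: "real i \<le> 2 * 2 ^ m" using assms(3) by (metis of_nat_le_iff of_nat_mult of_nat_numeral of_nat_power)
  have "0 \<le> two_phase_grid r T m i \<and> two_phase_grid r T m i \<le> r + T"
  proof (cases "i \<le> 2 ^ m")
    case True
    then have "real i / 2 ^ m \<le> 1" by (simp add: divide_le_eq)
    then have "r * (real i / 2 ^ m) \<le> r * 1" using assms by (intro mult_left_mono) auto
    then show ?thesis using True assms by (simp add: two_phase_grid_def)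
  next
    case False
    then have "2 ^ m \<le> real i" by (metis nat_le_linear of_nat_le_iff of_nat_numeral of_nat_power)
    moreover from this have "T * ((real i - 2 ^ m) / 2 ^ m) \<le> T * 1"
      using assms i by (intro mult_left_mono) (auto simp: divide_le_eq)
    ultimately show ?thesis using False assms by (simp add: two_phase_grid_def)
  qed
  then show "0 \<le> two_phase_grid r T m i" "two_phase_grid r T m i \<le> r + T" by auto
qed

lemma two_phase_grid_refine:
  "two_phase_grid r T m i = two_phase_grid r T (Suc m) (2 * i)"
proof -
  have "2 * i \<le> 2 ^ Suc m \<longleftrightarrow> i \<le> 2 ^ m" by simp
  then show ?thesis unfolding two_phase_grid_def by (auto simp: field_simps)
qed

lemma two_phase_grid_set:
  assumes "0 < r" "0 < T"
  defines "G m \<equiv> two_phase_grid r T m ` Suc ` {..<2 * 2 ^ m}"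
  shows "finite (G m)" "G m \<subseteq> {0..r + T}" "incseq G" "r + T \<in> (\<Union>m. G m)"
    and "0 \<le> t \<Longrightarrow> t < r + T \<Longrightarrow> 0 < e \<Longrightarrow> \<exists>s\<in>(\<Union>m. G m). t < s \<and> s < t + e"
proof -
  show "finite (G m)" "G m \<subseteq> {0..r + T}"
    using two_phase_grid_range[OF assms(1,2)] by (auto simp: G_def Suc_le_eq)
  show "incseq G"
  proof (rule incseq_SucI, rule subsetI)
    fix m s assume "s \<in> G m"
    then obtain i where i: "s = two_phase_grid r T m (Suc i)" "i < 2 * 2 ^ m" by (auto simp: G_def)
    then have "s = two_phase_grid r T (Suc m) (Suc (2 * i + 1))"
      using two_phase_grid_refine[of r T m "Suc i"] by simp
    moreover have "2 * i + 1 < 2 * 2 ^ Suc m" using i(2) by simp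
    ultimately show "s \<in> G (Suc m)" unfolding G_def by blast
  qed
  have "two_phase_grid r T 0 (Suc 1) \<in> G 0" by (auto simp: G_def)
  then show "r + T \<in> (\<Union>m. G m)" by (auto simp: two_phase_grid_def)
  show "\<exists>s\<in>(\<Union>m. G m). t < s \<and> s < t + e" if t: "0 \<le> t" "t < r + T" "0 < e"
  proof (cases "t < r")
    case True
    obtain m k :: nat where mk: "k < 2 ^ m" "t < r * real (Suc k) / 2 ^ m" "r * real (Suc k) / 2 ^ m < t + e"
      using dyadic_between[OF t(1) True t(3)] .
    have "two_phase_grid r T m (Suc k) = r * real (Suc k) / 2 ^ m"
      using mk(1) by (simp add: two_phase_grid_def)
    moreover have "two_phase_grid r T m (Suc k) \<in> G m" using mk(1) by (auto simp: G_def)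
    ultimately show ?thesis using mk by fastforce
  next
    case False
    obtain m k :: nat where mk: "k < 2 ^ m" "t - r < T * real (Suc k) / 2 ^ m" "T * real (Suc k) / 2 ^ m < t - r + e"
    proof (rule dyadic_between)
      show "0 \<le> t - r" "t - r < T" "0 < e" using False t by auto
    qed
    have "two_phase_grid r T m (2 ^ m + Suc k) \<in> G m" using mk(1) by (auto simp: G_def)
    moreover have "two_phase_grid r T m (2 ^ m + Suc k) = r + T * real (Suc k) / 2 ^ m"
      by (rule two_phase_grid_second)
    ultimately show ?thesis using mk by (intro bexI[of _ "r + T * real (Suc k) / 2 ^ m"]) auto
  qed
qed

context levy_process
begin

lemma prob_below_le_surv:
  assumes "0 < T"
  shows "prob_below M X (\<lambda>_. c) T \<le> surv (\<lambda>_. law (T / 2 ^ m)) (\<lambda>_ _. 1) (\<lambda>_. c) (2 ^ m) 0"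
proof -
  define \<tau> where "\<tau> i = T * real i / 2 ^ m" for i
  have \<tau>: "\<tau> 0 = 0" "\<tau> i < \<tau> (Suc i)" "\<tau> (Suc i) - \<tau> i = T / 2 ^ m" for i
    using assms by (auto simp: \<tau>_def field_simps)
  have le: "\<tau> (Suc i) \<in> {0..T}" if "i < 2 ^ m" for i
  proof -
    have "real (Suc i) \<le> 2 ^ m" using that by (metis Suc_leI of_nat_le_iff of_nat_numeral of_nat_power)
    then show ?thesis using assms by (simp add: \<tau>_def field_simps del: of_nat_Suc)
  qed
  have "prob_below M X (\<lambda>_. c) T \<le> prob {\<omega> \<in> space M. \<forall>t\<in>(\<lambda>i. \<tau> (Suc i)) ` {..<2 ^ m}. X t \<omega> \<le> c}"
    using le by (intro prob_below_grid_le) auto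
  also have "\<dots> = prob {\<omega> \<in> space M. \<forall>i<2 ^ m. X (\<tau> (Suc i)) \<omega> \<le> c}"
    by (rule arg_cong[where f=prob]) (simp only: ball_image_lessThan)
  also have "\<dots> = surv (\<lambda>i. law (\<tau> (Suc i) - \<tau> i)) (\<lambda>_ _. 1) (\<lambda>_. c) (2 ^ m) 0"
    by (rule prob_grid_below) (fact \<tau>)+
  finally show ?thesis by (simp add: \<tau>)
qed

lemma two_phase_limit:
  assumes "\<And>t. 0 \<le> t \<Longrightarrow> continuous (at_right t) g" "0 < r" "0 < T"
  shows "{\<omega> \<in> space M. \<forall>t\<in>{0..r + T}. X t \<omega> \<le> g t} \<in> sets (completion M)"
    and "(\<lambda>m. surv (\<lambda>i. if i < 2 ^ m then law (r / 2 ^ m) else law (T / 2 ^ m)) (\<lambda>_ _. 1)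
            (\<lambda>i. g (two_phase_grid r T m (Suc i))) (2 ^ m + 2 ^ m) 0)
          \<longlonglongrightarrow> prob_below M X g (r + T)"
proof -
  note G = two_phase_grid_set[OF assms(2,3)]
  show "{\<omega> \<in> space M. \<forall>t\<in>{0..r + T}. X t \<omega> \<le> g t} \<in> sets (completion M)"
    by (rule below_grid_limit(1)[OF assms(1) G])
  have lim: "(\<lambda>m. prob {\<omega> \<in> space M. \<forall>t\<in>two_phase_grid r T m ` Suc ` {..<2 * 2 ^ m}. X t \<omega> \<le> g t})
      \<longlonglongrightarrow> prob_below M X g (r + T)"
    by (rule below_grid_limit(2)[OF assms(1) G])
  have "prob {\<omega> \<in> space M. \<forall>t\<in>two_phase_grid r T m ` Suc ` {..<2 * 2 ^ m}. X t \<omega> \<le> g t}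
    = surv (\<lambda>i. if i < 2 ^ m then law (r / 2 ^ m) else law (T / 2 ^ m)) (\<lambda>_ _. 1)
        (\<lambda>i. g (two_phase_grid r T m (Suc i))) (2 ^ m + 2 ^ m) 0" for m
  proof -
    let ?\<tau> = "two_phase_grid r T m"
    have "{\<omega> \<in> space M. \<forall>t\<in>?\<tau> ` Suc ` {..<2 * 2 ^ m}. X t \<omega> \<le> g t}
        = {\<omega> \<in> space M. \<forall>i<2 ^ m + 2 ^ m. X (?\<tau> (Suc i)) \<omega> \<le> g (?\<tau> (Suc i))}"
      by (simp only: image_image ball_image_lessThan mult_2)
    also have "prob \<dots> = surv (\<lambda>i. law (?\<tau> (Suc i) - ?\<tau> i)) (\<lambda>_ _. 1) (\<lambda>i. g (?\<tau> (Suc i))) (2 ^ m + 2 ^ m) 0"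
    proof (rule prob_grid_below)
      show "?\<tau> 0 = 0" by (simp add: two_phase_grid_def)
      show "?\<tau> i < ?\<tau> (Suc i)" for i
        using two_phase_grid_step[of r T m i] assms(2,3) by (auto split: if_splits simp: algebra_simps)
    qed
    also have "(\<lambda>i. law (?\<tau> (Suc i) - ?\<tau> i)) = (\<lambda>i. if i < 2 ^ m then law (r / 2 ^ m) else law (T / 2 ^ m))"
      by (auto simp: two_phase_grid_step)
    finally show ?thesis .
  qed
  then show "(\<lambda>m. surv (\<lambda>i. if i < 2 ^ m then law (r / 2 ^ m) else law (T / 2 ^ m)) (\<lambda>_ _. 1)
            (\<lambda>i. g (two_phase_grid r T m (Suc i))) (2 ^ m + 2 ^ m) 0)
          \<longlonglongrightarrow> prob_below M X g (r + T)" using lim by simp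
qed

text \<open>Serves monotonicity of the probabilities: as \<open>measure\<close> is 0 on
  non-measurable sets, the larger of two events has to be measurable.\<close>

lemma sets_below:
  assumes "\<And>t. 0 \<le> t \<Longrightarrow> continuous (at_right t) g" "0 < T"
  shows "{\<omega> \<in> space M. \<forall>t\<in>{0..T}. X t \<omega> \<le> g t} \<in> sets (completion M)"
  using two_phase_limit(1)[OF assms(1), of "T / 2" "T / 2"] assms(2) by simp

lemma prob_below_antimono:
  assumes "\<And>t. 0 \<le> t \<Longrightarrow> continuous (at_right t) g" "\<And>t. 0 \<le> t \<Longrightarrow> continuous (at_right t) g'"
    and "0 < T'" "T' \<le> T" "\<And>t. 0 \<le> t \<Longrightarrow> t \<le> T' \<Longrightarrow> g t \<le> g' t"
  shows "prob_below M X g T \<le> prob_below M X g' T'"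
proof -
  interpret C: finite_measure "completion M"
    by (rule finite_measureI) (simp add: emeasure_space_1)
  show ?thesis unfolding prob_below_def
  proof (rule C.finite_measure_mono)
    show "{\<omega> \<in> space M. \<forall>t\<in>{0..T}. X t \<omega> \<le> g t} \<subseteq> {\<omega> \<in> space M. \<forall>t\<in>{0..T'}. X t \<omega> \<le> g' t}"
      using assms(4,5) by (auto, meson atLeastAtMost_iff order_trans)
  qed (rule sets_below[OF assms(2,3)])
qed

text \<open>Right-continuity at 0 and \<open>X 0 = 0\<close> keep almost every path below
  \<open>c\<close> on some interval \<open>[0, 1 / (n + 1)]\<close>; these events increase with
  \<open>n\<close>, so one of them has positive probability.\<close>

lemma prob_below_const_pos:
  assumes "0 < c"
  obtains r0 where "0 < r0" "\<And>r. 0 < r \<Longrightarrow> r \<le> r0 \<Longrightarrow> 0 < prob_below M X (\<lambda>_. c) r"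
proof -
  interpret C: prob_space "completion M"
    by (rule prob_spaceI) (simp add: emeasure_space_1)
  define E where "E n = {\<omega> \<in> space M. \<forall>t\<in>{0..1 / real (Suc n)}. X t \<omega> \<le> c}" for n
  have E: "E n \<in> sets (completion M)" for n unfolding E_def by (rule sets_below) auto
  have "incseq E"
  proof (rule incseq_SucI)
    fix n
    have "1 / real (Suc (Suc n)) \<le> 1 / real (Suc n)" by (simp add: frac_le)
    then show "E n \<le> E (Suc n)" unfolding E_def by fastforce
  qed
  have "AE \<omega> in M. \<omega> \<in> (\<Union>n. E n)"
    using starts_at_0 cadlag_paths AE_space
  proof eventually_elim
    case (elim \<omega>)
    have "continuous (at_right 0) (\<lambda>t. X t \<omega>)" using elim(2) by (simp add: cadlag_def)
    then have "((\<lambda>t. X t \<omega>) \<longlongrightarrow> 0) (at_right 0)" using elim(1) by (simp add: continuous_within)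
    then have "\<forall>\<^sub>F t in at_right 0. X t \<omega> < c" using assms by (rule order_tendstoD(2))
    then obtain u where u: "0 < u" "\<And>t. 0 < t \<Longrightarrow> t < u \<Longrightarrow> X t \<omega> < c"
      unfolding eventually_at_right_field by auto
    obtain n where n: "1 / real (Suc n) < u" using u(1) nat_approx_posE by blast
    have "X t \<omega> \<le> c" if "t \<in> {0..1 / real (Suc n)}" for t
      using that u(2)[of t] n elim assms by (cases "t = 0") auto
    then have "\<omega> \<in> E n" using elim(3) by (simp add: E_def)
    then show ?case by blast
  qed
  then have "C.prob (\<Union>n. E n) = 1"
    using E by (intro C.prob_eq_1[THEN iffD2]) (auto intro: AE_completion)
  moreover have "(\<lambda>n. C.prob (E n)) \<longlonglongrightarrow> C.prob (\<Union>n. E n)"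
    using E \<open>incseq E\<close> by (intro C.finite_Lim_measure_incseq) auto
  ultimately have "\<forall>\<^sub>F n in sequentially. 0 < C.prob (E n)"
    by (intro order_tendstoD(1)) auto
  then obtain n where n: "0 < C.prob (E n)" by (auto simp: eventually_sequentially)
  show thesis
  proof (rule that[of "1 / real (Suc n)"])
    fix r :: real assume r: "0 < r" "r \<le> 1 / real (Suc n)"
    have "0 < prob_below M X (\<lambda>_. c) (1 / real (Suc n))"
      using n by (simp add: prob_below_def E_def)
    also have "\<dots> \<le> prob_below M X (\<lambda>_. c) r" using r by (intro prob_below_antimono) auto
    finally show "0 < prob_below M X (\<lambda>_. c) r" .
  qed simp
qed

end

subsection \<open>Comparison of the boundaries\<close>

text \<open>A Riemann sum at right end points of a decreasing function; nonnegativity makes the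
  square decreasing as well. The cell belonging to \<open>k = 0\<close> begins at
  \<open>a - h\<close>, which is why \<open>l\<close> and \<open>t0\<close> must not exceed
  \<open>a - h\<close>.\<close>

lemma sum_squares_le_integral:
  fixes \<phi> :: "real \<Rightarrow> real" and n :: nat
  assumes \<phi>: "antimono_on {t0..} \<phi>" "\<And>t. t0 \<le> t \<Longrightarrow> 0 \<le> \<phi> t"
    and int: "set_integrable lborel {l..} (\<lambda>s. (\<phi> s)\<^sup>2)"
    and "0 < h" "l \<le> a - h" "t0 \<le> a - h"
  shows "h * (\<Sum>k<n. (\<phi> (a + real k * h))\<^sup>2) \<le> set_lebesgue_integral lborel {l..} (\<lambda>s. (\<phi> s)\<^sup>2)"
proof -
  define J where "J k = {a + (real k - 1) * h<..a + real k * h}" for k :: nat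
  have Jl: "J k \<subseteq> {l..}" for k
  proof
    fix s assume "s \<in> J k"
    moreover have "(real k - 1) * h \<ge> - h" using \<open>0 < h\<close> by (simp add: algebra_simps)
    ultimately show "s \<in> {l..}" using assms(5) by (auto simp: J_def)
  qed
  have Jint: "set_integrable lborel (J k) (\<lambda>s. (\<phi> s)\<^sup>2)" for k
    using int by (rule set_integrable_subset) (use Jl in \<open>auto simp: J_def\<close>)
  have disj: "disjoint_family_on J {..<n}"
  proof -
    have "J i \<inter> J j = {}" if "i < j" for i j
    proof -
      have "real i * h \<le> (real j - 1) * h" using that \<open>0 < h\<close> by (intro mult_right_mono) auto
      then show ?thesis by (auto simp: J_def)
    qed
    then show ?thesis unfolding disjoint_family_on_def by (metis Int_commute nat_neq_iff)
  qed
  have "h * (\<phi> (a + real k * h))\<^sup>2 \<le> set_lebesgue_integral lborel (J k) (\<lambda>s. (\<phi> s)\<^sup>2)" for k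
  proof -
    have "h * (\<phi> (a + real k * h))\<^sup>2 = set_lebesgue_integral lborel (J k) (\<lambda>_. (\<phi> (a + real k * h))\<^sup>2)"
      using \<open>0 < h\<close> by (simp add: J_def set_lebesgue_integral_def algebra_simps)
    also have "\<dots> \<le> set_lebesgue_integral lborel (J k) (\<lambda>s. (\<phi> s)\<^sup>2)"
    proof (rule set_integral_mono[OF _ Jint])
      show "set_integrable lborel (J k) (\<lambda>_. (\<phi> (a + real k * h))\<^sup>2)"
        unfolding set_integrable_def real_scaleR_def J_def
        using \<open>0 < h\<close> by (intro integrable_mult_left integrable_real_indicator) (auto simp: algebra_simps)
      fix s assume s: "s \<in> J k"
      have "(real k - 1) * h \<ge> - h" using \<open>0 < h\<close> by (simp add: algebra_simps)
      then have "t0 \<le> s" "s \<le> a + real k * h" using s assms(6) by (auto simp: J_def)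
      then have "\<phi> (a + real k * h) \<le> \<phi> s" using \<phi>(1) by (auto simp: monotone_on_def)
      then show "(\<phi> (a + real k * h))\<^sup>2 \<le> (\<phi> s)\<^sup>2"
        using \<phi>(2) \<open>t0 \<le> s\<close> \<open>s \<le> a + real k * h\<close> by (intro power_mono) auto
    qed
    finally show ?thesis .
  qed
  then have "h * (\<Sum>k<n. (\<phi> (a + real k * h))\<^sup>2) \<le> (\<Sum>k<n. set_lebesgue_integral lborel (J k) (\<lambda>s. (\<phi> s)\<^sup>2))"
    unfolding sum_distrib_left by (intro sum_mono) auto
  also have "\<dots> = set_lebesgue_integral lborel (\<Union>k\<in>{..<n}. J k) (\<lambda>s. (\<phi> s)\<^sup>2)"
    using Jint by (intro set_integral_finite_Union[symmetric] disj) (auto simp: J_def)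
  also have "\<dots> \<le> set_lebesgue_integral lborel {l..} (\<lambda>s. (\<phi> s)\<^sup>2)"
    unfolding set_lebesgue_integral_def
  proof (rule integral_mono)
    have "set_integrable lborel (\<Union>k\<in>{..<n}. J k) (\<lambda>s. (\<phi> s)\<^sup>2)"
      using int by (rule set_integrable_subset) (use Jl in \<open>auto simp: J_def\<close>)
    then show "integrable lborel (\<lambda>s. indicat_real (\<Union>k\<in>{..<n}. J k) s *\<^sub>R (\<phi> s)\<^sup>2)"
      by (simp only: set_integrable_def)
    show "integrable lborel (\<lambda>s. indicat_real {l..} s *\<^sub>R (\<phi> s)\<^sup>2)"
      using int by (simp only: set_integrable_def)
    show "indicat_real (\<Union>k\<in>{..<n}. J k) s *\<^sub>R (\<phi> s)\<^sup>2 \<le> indicat_real {l..} s *\<^sub>R (\<phi> s)\<^sup>2" for s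
      using Jl by (intro scaleR_right_mono indicator_leI) (blast, simp)
  qed
  finally show ?thesis .
qed

context levy_process
begin

text \<open>Stated along sequences of meshes, because it comes from weak convergence of a sequence
  of laws.\<close>

definition jump_rate :: "real \<Rightarrow> real \<Rightarrow> bool" where
  "jump_rate \<epsilon> \<rho> \<longleftrightarrow> 0 < \<epsilon> \<and> 0 < \<rho> \<and>
     (\<forall>h. h \<longlonglongrightarrow> 0 \<longrightarrow> (\<forall>m::nat. 0 < h m) \<longrightarrow>
       (\<forall>\<^sub>F m in sequentially. \<rho> * h m \<le> measure (law (h m)) {..-\<epsilon>}))"

text \<open>Jumps occur with probability \<open>h \<phi> / (1 - exp (-\<epsilon>))\<close>, where
  \<open>\<phi>\<close> bounds the slope of \<open>F\<close>. As the mass of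
  \<open>{..-\<epsilon>}\<close> is at least \<open>\<rho> h\<close>, the ratio of the two is
  bounded uniformly in the mesh, and so is the exponent in the moment bound. The boundary
  \<open>b\<close> is quantified after \<open>m\<close>, so it may depend on the mesh.\<close>

lemma surv_phase_ge:
  assumes J: "jump_rate \<epsilon> \<rho>" and "0 < T" "1 < p"
    and \<phi>: "\<And>t. 0 \<le> t \<Longrightarrow> 0 \<le> \<phi> t" "\<And>t. 0 \<le> t \<Longrightarrow> \<phi> t \<le> \<Phi>"
    and F: "\<And>t h. 0 \<le> t \<Longrightarrow> 0 < h \<Longrightarrow> F (t + h) - F t \<le> h * \<phi> t"
    and I: "\<forall>\<^sub>F m in sequentially. T / 2 ^ m * (\<Sum>k<2 ^ m. (\<phi> (real k * (T / 2 ^ m)))\<^sup>2) \<le> I"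
    and C: "0 \<le> C" "\<And>x. -1 \<le> x \<Longrightarrow> x \<le> \<Phi> / (1 - exp (-\<epsilon>)) / \<rho> \<Longrightarrow> (1 + x) ^ p \<le> 1 + real p * x + C * x\<^sup>2"
    and "0 \<le> c" "F 0 \<le> - x"
  shows "\<forall>\<^sub>F m in sequentially. \<forall>b. (\<forall>k<2 ^ m. c - F (real (Suc k) * (T / 2 ^ m)) \<le> b k) \<longrightarrow>
    exp (- (C * I / (1 - exp (-\<epsilon>))\<^sup>2 / \<rho>)) * (prob_below M X (\<lambda>_. c) T * (1 - exp (F 0 + x))) ^ p
      \<le> surv (\<lambda>_. law (T / 2 ^ m)) (\<lambda>_ _. 1) b (2 ^ m) x ^ (p - 1)"
proof -
  have \<epsilon>: "0 < \<epsilon>" and \<rho>: "0 < \<rho>" using J by (auto simp: jump_rate_def)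
  define \<beta> where "\<beta> = 1 - exp (-\<epsilon>)"
  have \<beta>: "0 < \<beta>" using \<epsilon> by (simp add: \<beta>_def)
  have h0: "(\<lambda>m. T / 2 ^ m) \<longlonglongrightarrow> 0"
    using LIMSEQ_divide_realpow_zero[of 2 T] by simp
  have \<Phi>: "0 \<le> \<Phi>" using \<phi>[of 0] by simp
  have "\<forall>\<^sub>F m in sequentially. \<rho> * (T / 2 ^ m) \<le> measure (law (T / 2 ^ m)) {..-\<epsilon>}"
    using J h0 \<open>0 < T\<close> unfolding jump_rate_def by (elim conjE allE[of _ "\<lambda>m. T / 2 ^ m"]) simp
  moreover have "\<forall>\<^sub>F m in sequentially. T / 2 ^ m * \<Phi> / \<beta> < 1"
    using \<beta> by (intro order_tendstoD(2)[where y="0 * \<Phi> / \<beta>"] tendsto_intros h0) auto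
  ultimately show ?thesis using I
  proof eventually_elim
    case (elim m)
    define h where "h = T / 2 ^ m"
    define a where "a = measure (law h) {..-\<epsilon>}"
    define e where "e k = h * \<phi> (real k * h) / \<beta>" for k :: nat
    have h: "0 < h" using \<open>0 < T\<close> by (simp add: h_def)
    have ah: "\<rho> * h \<le> a" using elim(1) by (simp add: a_def h_def)
    have a: "0 < a" using ah h \<rho> by (smt (verit) mult_pos_pos)
    have \<phi>k: "0 \<le> \<phi> (real k * h)" "\<phi> (real k * h) \<le> \<Phi>" for k :: nat using \<phi> h by auto
    have e: "0 \<le> e k" for k using \<phi>k h \<beta> by (simp add: e_def)
    have eh: "e k \<le> h * \<Phi> / \<beta>" for k
      unfolding e_def using \<phi>k h \<beta> by (intro divide_right_mono mult_left_mono) auto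
    have e1: "e k \<le> 1" for k using eh[of k] elim(2) by (simp add: h_def)
    have "h * \<Phi> / \<beta> = \<Phi> / \<beta> / \<rho> * (\<rho> * h)" using \<rho> by simp
    also have "\<dots> \<le> \<Phi> / \<beta> / \<rho> * a" using ah \<Phi> \<beta> \<rho> by (intro mult_left_mono) auto
    finally have e\<Theta>: "e k \<le> \<Phi> / \<beta> / \<rho> * a" for k using eh[of k] by simp
    \<comment> \<open>One factor \<open>h\<close> forms the Riemann sum bounded by \<open>I\<close>;
      the other will cancel against \<open>a \<ge> \<rho> h\<close>.\<close>
    have "(\<Sum>k<2 ^ m. (e k)\<^sup>2) = h / \<beta>\<^sup>2 * (h * (\<Sum>k<2 ^ m. (\<phi> (real k * h))\<^sup>2))"
      unfolding e_def by (simp add: power_mult_distrib power_divide power2_eq_square sum_distrib_left sum_divide_distrib mult_ac)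
    also have "\<dots> \<le> h / \<beta>\<^sup>2 * I" using h by (intro mult_left_mono elim(3)[folded h_def]) simp
    finally have "(\<Sum>k<2 ^ m. (e k)\<^sup>2) \<le> h / \<beta>\<^sup>2 * I" .
    moreover have "0 \<le> (\<Sum>k<2 ^ m. (e k)\<^sup>2)" by (intro sum_nonneg) auto
    ultimately have "(\<Sum>k<2 ^ m. (e k)\<^sup>2) / a \<le> h / \<beta>\<^sup>2 * I / (\<rho> * h)"
      using ah h \<rho> by (intro frac_le) auto
    also have "\<dots> = I / \<beta>\<^sup>2 / \<rho>" using h \<rho> by (simp add: field_simps)
    finally have sum: "C * (\<Sum>k<2 ^ m. (e k)\<^sup>2) / a \<le> C * I / \<beta>\<^sup>2 / \<rho>"
      using C(1) mult_left_mono[of "(\<Sum>k<2 ^ m. (e k)\<^sup>2) / a" "I / \<beta>\<^sup>2 / \<rho>" C] by simp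
    show ?case
    proof (intro allI impI)
      fix b assume b: "\<forall>k<2 ^ m. c - F (real (Suc k) * (T / 2 ^ m)) \<le> b k"
      let ?s = "surv (\<lambda>_. law h) (\<lambda>_ _. 1) (\<lambda>_. c) (2 ^ m) 0" and ?P = "prob_below M X (\<lambda>_. c) T"
      have x0: "0 \<le> 1 - exp (F 0 + x)" using \<open>F 0 \<le> - x\<close> by simp
      have "?P \<le> ?s" unfolding h_def by (rule prob_below_le_surv) fact
      then have "exp (- (C * I / \<beta>\<^sup>2 / \<rho>)) * (?P * (1 - exp (F 0 + x))) ^ p
          \<le> exp (- (C * (\<Sum>k<2 ^ m. (e k)\<^sup>2) / a)) * (?s * (1 - exp (F 0 + x))) ^ p"
        using sum x0 by (intro mult_mono power_mono mult_right_mono) (auto simp: prob_below_def)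
      also have "\<dots> = exp (- (C * (\<Sum>k<2 ^ m. (e k)\<^sup>2) / a)) * (?s * (1 - exp (F (real 0 * h) - (0 - x)))) ^ p"
        by simp
      also have "\<dots> \<le> surv (\<lambda>_. law h) (\<lambda>_ _. 1) b (2 ^ m) x ^ (p - 1)"
        unfolding a_def
      proof (rule surv_boundary_ge[where F="\<lambda>k. F (real k * h)"])
        show "F (real (Suc k) * h) - F (real k * h) \<le> e k * (1 - exp (-\<epsilon>))" for k
          using F[of "real k * h" h] h \<beta> by (simp add: e_def \<beta>_def[symmetric] algebra_simps)
        show "c - F (real (Suc k) * h) \<le> b k" if "k < 2 ^ m" for k
          using b that by (simp add: h_def)
        show "real_distribution (law h)" using h by (intro real_distribution_law) simp
        show "e k \<le> \<Phi> / \<beta> / \<rho> * measure (law h) {..-\<epsilon>}" for k using e\<Theta> by (simp add: a_def)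
      qed (use \<epsilon> a e e1 C assms in \<open>auto simp: a_def \<beta>_def\<close>)
      finally show "exp (- (C * I / (1 - exp (-\<epsilon>))\<^sup>2 / \<rho>)) * (?P * (1 - exp (F 0 + x))) ^ p
          \<le> surv (\<lambda>_. law (T / 2 ^ m)) (\<lambda>_ _. 1) b (2 ^ m) x ^ (p - 1)"
        by (simp add: \<beta>_def h_def)
    qed
  qed
qed

end

text \<open>On \<open>[0, r]\<close> the walk is made to descend to \<open>-K\<close> below a steep
  line; on \<open>[r, r + T]\<close> it starts from \<open>-K\<close> and stays below the moving
  boundary, in comparison with the constant 1. The cost \<open>P\<close> of the descent is fixed
  before \<open>p\<close>, while \<open>A\<close> may depend on \<open>p\<close>.\<close>

lemma (in levy_process) moving_boundary_comparison:
  fixes f f' :: "real \<Rightarrow> real"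
  assumes J: "jump_rate \<epsilon> \<rho>"
    and f: "\<And>t. t \<ge> 0 \<Longrightarrow> (f has_real_derivative f' t) (at t within {0..})" "mono_on {0..} f" "f 0 < 1"
    and f0: "\<And>t. t \<ge> 0 \<Longrightarrow> f t \<ge> 0"
    and f': "set_integrable lborel {1..} (\<lambda>s. (f' s)\<^sup>2)" "antimono_on {t0..} f'" "(f' \<longlongrightarrow> 0) at_top"
  obtains P where "0 < P"
    "\<And>p. 1 < p \<Longrightarrow> \<exists>A>0. \<forall>T>0.
       P * root (p - 1) (A * prob_below M X (\<lambda>t. 1) T ^ p) \<le> prob_below M X (\<lambda>t. 1 - f t) T"
proof -
  have \<epsilon>: "0 < \<epsilon>" and \<rho>: "0 < \<rho>" using J by (auto simp: jump_rate_def)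
  define \<beta> where "\<beta> = 1 - exp (-\<epsilon>)"
  have \<beta>: "0 < \<beta>" using \<epsilon> by (simp add: \<beta>_def)
  have cont: "continuous (at_right t) f" if "0 \<le> t" for t
    using DERIV_continuous[OF f(1)[OF that]] by (rule continuous_within_subset) (use that in auto)
  have cont': "continuous (at_right t) (\<lambda>t. 1 - f t)" if "0 \<le> t" for t
    using cont[OF that] by (intro continuous_intros)
  have mono: "f s \<le> f t" if "0 \<le> s" "s \<le> t" for s t
    using f(2) that by (auto simp: monotone_on_def)
  have f'nn: "0 \<le> f' t" if "t0 \<le> t" for t
  proof (rule tendsto_upperbound[OF f'(3)])
    show "\<forall>\<^sub>F s in at_top. f' s \<le> f' t"
      using eventually_ge_at_top[of t] by eventually_elim (use f'(2) that in \<open>auto simp: monotone_on_def\<close>)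
  qed simp
  \<comment> \<open>A mesh below 1 then leaves the cell to the left of \<open>a\<close> inside the
    region where \<open>f'\<close> is monotone and its square integrable.\<close>
  define a where "a = max t0 1 + 1"
  have a: "t0 + 1 \<le> a" "2 \<le> a" by (auto simp: a_def)
  \<comment> \<open>The margin below the boundary at time 0 is \<open>4 y\<close>: up to time
    \<open>r\<close> the boundary stays above \<open>2 y\<close>, where the descending line starts,
    and the untilted walk of the first phase is kept below \<open>y\<close>.\<close>
  define y where "y = (1 - f 0) / 4"
  have y: "0 < y" using f(3) by (simp add: y_def)
  \<comment> \<open>The second phase starts at \<open>-K\<close>, so that there
    \<open>F 0 + x = f a - K = -1\<close>.\<close>
  define K where "K = f a + 1"
  have K: "1 \<le> K" using f0[of a] a by (simp add: K_def)
  have "(f \<longlongrightarrow> f 0) (at_right 0)" using cont[of 0] by (simp add: continuous_within)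
  then have "\<forall>\<^sub>F t in at_right 0. f t < 1 - 2 * y" using f(3) by (intro order_tendstoD(2)) (auto simp: y_def field_simps)
  then obtain r1 where r1: "0 < r1" "\<And>t. 0 < t \<Longrightarrow> t < r1 \<Longrightarrow> f t < 1 - 2 * y"
    unfolding eventually_at_right_field by auto
  obtain r0 where r0: "0 < r0" "\<And>r. 0 < r \<Longrightarrow> r \<le> r0 \<Longrightarrow> 0 < prob_below M X (\<lambda>_. y) r"
    using prob_below_const_pos[OF y] by blast
  define r where "r = min (min (r1 / 2) r0) 1"
  have r: "0 < r" "r \<le> a" "0 < prob_below M X (\<lambda>_. y) r" "f r < 1 - 2 * y"
    using r0 r1 a by (auto simp: r_def)
  \<comment> \<open>The slope for which the line \<open>2 y - sl t\<close> takes the value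
    \<open>-K\<close> at \<open>t = r\<close>.\<close>
  define sl where "sl = (2 * y + K) / r"
  have sl: "0 < sl" "sl * r = 2 * y + K" using y K r by (auto simp: sl_def)
  obtain C1 where C1: "0 \<le> C1"
    "\<And>x. -1 \<le> x \<Longrightarrow> x \<le> sl / \<beta> / \<rho> \<Longrightarrow> (1 + x) ^ 2 \<le> 1 + real 2 * x + C1 * x\<^sup>2"
    using one_plus_power_le_quadratic[of "sl / \<beta> / \<rho>" 2] sl \<beta> \<rho> by auto
  \<comment> \<open>The first phase has a fixed length, so the exponent 2 suffices; with it the
    power \<open>p - 1\<close> is 1 and no root is taken.\<close>
  define P where "P = exp (- (C1 * (r * sl\<^sup>2) / \<beta>\<^sup>2 / \<rho>)) * (prob_below M X (\<lambda>_. y) r * (1 - exp (- y))) ^ 2"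
  have P: "0 < P" using r(3) y by (simp add: P_def)
  define b' where "b' m k = y - (- y + sl * (real (Suc k) * (r / 2 ^ m)))" for m k :: nat
  have phase1: "\<forall>\<^sub>F m in sequentially. P \<le> surv (\<lambda>_. law (r / 2 ^ m)) (\<lambda>_ _. 1) (b' m) (2 ^ m) 0"
  proof -
    have "\<forall>\<^sub>F m in sequentially. \<forall>b. (\<forall>k<2 ^ m. y - (- y + sl * (real (Suc k) * (r / 2 ^ m))) \<le> b k) \<longrightarrow>
      exp (- (C1 * (r * sl\<^sup>2) / (1 - exp (-\<epsilon>))\<^sup>2 / \<rho>)) * (prob_below M X (\<lambda>_. y) r * (1 - exp (- y + sl * 0 + 0))) ^ 2
        \<le> surv (\<lambda>_. law (r / 2 ^ m)) (\<lambda>_ _. 1) b (2 ^ m) 0 ^ (2 - 1)"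
    proof (rule surv_phase_ge[OF J r(1), where F="\<lambda>t. - y + sl * t" and \<phi>="\<lambda>_. sl"])
      show "(1 + x) ^ 2 \<le> 1 + real 2 * x + C1 * x\<^sup>2" if "-1 \<le> x" "x \<le> sl / (1 - exp (-\<epsilon>)) / \<rho>" for x
        using C1(2)[OF that[folded \<beta>_def]] .
    qed (use sl y C1 in \<open>auto simp: algebra_simps\<close>)
    then show ?thesis by eventually_elim (simp add: P_def \<beta>_def b'_def)
  qed
  have "\<exists>A>0. \<forall>T>0. P * root (p - 1) (A * prob_below M X (\<lambda>t. 1) T ^ p) \<le> prob_below M X (\<lambda>t. 1 - f t) T"
    if p: "1 < p" for p
  proof -
    have fa: "0 \<le> f' a" using f'nn[of a] a by simp
    obtain C where C: "0 \<le> C"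
      "\<And>x. -1 \<le> x \<Longrightarrow> x \<le> f' a / \<beta> / \<rho> \<Longrightarrow> (1 + x) ^ p \<le> 1 + real p * x + C * x\<^sup>2"
      using one_plus_power_le_quadratic[of "f' a / \<beta> / \<rho>" p] fa \<beta> \<rho> by auto
    define I where "I = set_lebesgue_integral lborel {1..} (\<lambda>s. (f' s)\<^sup>2)"
    define A where "A = exp (- (C * I / \<beta>\<^sup>2 / \<rho>)) * (1 - exp (- 1)) ^ p"
    have A: "0 < A" by (simp add: A_def)
    have "P * root (p - 1) (A * prob_below M X (\<lambda>t. 1) T ^ p) \<le> prob_below M X (\<lambda>t. 1 - f t) T"
      if T: "0 < T" for T
    proof -
      let ?P1 = "prob_below M X (\<lambda>t. 1) T"
      \<comment> \<open>The boundary is read from \<open>a\<close> on, where \<open>f'\<close> is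
        monotone. As \<open>r \<le> a\<close> and \<open>f\<close> is non-decreasing,
        \<open>1 - f (a + t)\<close> is more demanding than \<open>1 - f (r + t)\<close>.\<close>
      have phase2: "\<forall>\<^sub>F m in sequentially. \<forall>b. (\<forall>k<2 ^ m. 1 - f (a + real (Suc k) * (T / 2 ^ m)) \<le> b k) \<longrightarrow>
        exp (- (C * I / (1 - exp (-\<epsilon>))\<^sup>2 / \<rho>)) * (?P1 * (1 - exp (f (a + 0) + - K))) ^ p
          \<le> surv (\<lambda>_. law (T / 2 ^ m)) (\<lambda>_ _. 1) b (2 ^ m) (- K) ^ (p - 1)"
      proof (rule surv_phase_ge[OF J T p, where F="\<lambda>t. f (a + t)" and \<phi>="\<lambda>t. f' (a + t)"])
        show "0 \<le> f' (a + t)" if "0 \<le> t" for t using f'nn[of "a + t"] a that by simp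
        show "f' (a + t) \<le> f' a" if "0 \<le> t" for t using f'(2) a that by (auto simp: monotone_on_def)
        show "f (a + (t + h)) - f (a + t) \<le> h * f' (a + t)" if th: "0 \<le> t" "0 < h" for t h
        proof -
          have D: "(f has_real_derivative f' s) (at s)" if "a + t \<le> s" for s
          proof -
            have s: "0 < s" using that th a by simp
            then have "at s within {0..} = at s" by (intro at_within_interior) simp
            then show ?thesis using f(1)[of s] s by simp
          qed
          obtain z where z: "a + t < z" "f (a + t + h) - f (a + t) = (a + t + h - (a + t)) * f' z"
            using MVT2[of "a + t" "a + t + h" f f'] th D by auto
          moreover have "f' z \<le> f' (a + t)" using f'(2) a th z(1) by (auto simp: monotone_on_def)
          ultimately show ?thesis using th by (simp add: add.assoc)
        qed
        have "(\<lambda>m. T / 2 ^ m) \<longlonglongrightarrow> 0" using LIMSEQ_divide_realpow_zero[of 2 T] by simp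
        then have "\<forall>\<^sub>F m in sequentially. T / 2 ^ m < 1" by (rule order_tendstoD(2)) simp
        then show "\<forall>\<^sub>F m in sequentially. T / 2 ^ m * (\<Sum>k<2 ^ m. (f' (a + real k * (T / 2 ^ m)))\<^sup>2) \<le> I"
        proof eventually_elim
          case (elim m)
          then have "1 \<le> a - T / 2 ^ m" "t0 \<le> a - T / 2 ^ m" using a by linarith+
          then show ?case unfolding I_def
            using T by (intro sum_squares_le_integral[OF f'(2) f'nn f'(1)]) auto
        qed
        show "(1 + x) ^ p \<le> 1 + real p * x + C * x\<^sup>2" if "-1 \<le> x" "x \<le> f' a / (1 - exp (-\<epsilon>)) / \<rho>" for x
          using C(2)[OF that[folded \<beta>_def]] .
      qed (use C in \<open>auto simp: K_def\<close>)
      let ?\<tau> = "two_phase_grid r T"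
      let ?\<mu> = "\<lambda>m i. if i < 2 ^ m then law (r / 2 ^ m) else law (T / 2 ^ m)"
      have "\<forall>\<^sub>F m in sequentially. P * root (p - 1) (A * ?P1 ^ p)
        \<le> surv (?\<mu> m) (\<lambda>_ _. 1) (\<lambda>i. 1 - f (?\<tau> m (Suc i))) (2 ^ m + 2 ^ m) 0"
        using phase1 phase2
      proof eventually_elim
        case (elim m)
        let ?b = "\<lambda>i. 1 - f (?\<tau> m (Suc i))"
        let ?S = "surv (\<lambda>_. law (T / 2 ^ m)) (\<lambda>_ _. 1) (\<lambda>k. ?b (2 ^ m + k)) (2 ^ m) (- K)"
        have d: "real_distribution (?\<mu> m k)" for k using r T by (simp add: real_distribution_law)
        have S0: "0 \<le> ?S"
          using T by (intro surv_nonneg[OF step_weights_one]) (simp add: real_distribution_law)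
        have "A * ?P1 ^ p = exp (- (C * I / (1 - exp (-\<epsilon>))\<^sup>2 / \<rho>)) * (?P1 * (1 - exp (f (a + 0) + - K))) ^ p"
          by (simp add: A_def K_def \<beta>_def power_mult_distrib)
        also have "\<dots> \<le> ?S ^ (p - 1)"
        proof (rule elim(2)[rule_format])
          fix k :: nat
          have "?\<tau> m (Suc (2 ^ m + k)) = r + real (Suc k) * (T / 2 ^ m)"
            using two_phase_grid_second[of r T m "Suc k"] by (simp add: mult.commute)
          moreover have "f (r + real (Suc k) * (T / 2 ^ m)) \<le> f (a + real (Suc k) * (T / 2 ^ m))"
            using r T by (intro mono) auto
          ultimately show "1 - f (a + real (Suc k) * (T / 2 ^ m)) \<le> ?b (2 ^ m + k)" by simp
        qed
        finally have "root (p - 1) (A * ?P1 ^ p) \<le> root (p - 1) (?S ^ (p - 1))"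
          using p by (simp add: real_root_le_iff)
        then have S: "root (p - 1) (A * ?P1 ^ p) \<le> ?S" using p S0 by (simp add: real_root_power_cancel)
        have "P * root (p - 1) (A * ?P1 ^ p) \<le> surv (\<lambda>_. law (r / 2 ^ m)) (\<lambda>_ _. 1) (b' m) (2 ^ m) 0 * ?S"
          using elim(1) S P A by (intro mult_mono real_root_ge_zero) (auto simp: prob_below_def)
        also have "surv (\<lambda>_. law (r / 2 ^ m)) (\<lambda>_ _. 1) (b' m) (2 ^ m) 0 = surv (?\<mu> m) (\<lambda>_ _. 1) (b' m) (2 ^ m) 0"
          by (rule surv_cong) simp
        also have "?S = surv (\<lambda>k. ?\<mu> m (2 ^ m + k)) (\<lambda>_ _. 1) (\<lambda>k. ?b (2 ^ m + k)) (2 ^ m) (- K)"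
          by simp
        also have "surv (?\<mu> m) (\<lambda>_ _. 1) (b' m) (2 ^ m) 0 * \<dots> \<le> surv (?\<mu> m) (\<lambda>_ _. 1) ?b (2 ^ m + 2 ^ m) 0"
        \<comment> \<open>The two phases meet at step \<open>2 ^ m\<close>, where the descending
          line has reached \<open>-K\<close>.\<close>
        proof (rule surv_split[OF d])
          fix k :: nat assume k: "k < 2 ^ m"
          have "real (Suc k) \<le> 2 ^ m" using k by (metis Suc_leI of_nat_le_iff of_nat_numeral of_nat_power)
          then have "r * (real (Suc k) / 2 ^ m) \<le> r * 1" using r(1) by (intro mult_left_mono) (auto simp: divide_le_eq)
          moreover have "?\<tau> m (Suc k) = r * real (Suc k) / 2 ^ m" using k by (simp add: two_phase_grid_def)
          ultimately have "f (?\<tau> m (Suc k)) \<le> f r" using r(1) by (intro mono) auto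
          moreover have "0 \<le> sl * (real (Suc k) * (r / 2 ^ m))" using sl(1) r(1) by auto
          ultimately show "b' m k \<le> ?b k" using r(4) unfolding b'_def by linarith
        next
          have "real (Suc (2 ^ m - 1)) * (r / 2 ^ m) = r" by simp
          then show "b' m (2 ^ m - 1) \<le> - K" using sl(2) unfolding b'_def by simp
        qed simp
        finally show ?case .
      qed
      then have "P * root (p - 1) (A * ?P1 ^ p) \<le> prob_below M X (\<lambda>t. 1 - f t) (r + T)"
        by (intro tendsto_lowerbound[OF two_phase_limit(2)[OF cont' r(1) T]]) auto
      also have "\<dots> \<le> prob_below M X (\<lambda>t. 1 - f t) T"
        using r T by (intro prob_below_antimono cont') auto
      finally show ?thesis .
    qed
    then show ?thesis using A by blast
  qed
  then show thesis using that[OF P] by blast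
qed

section \<open>Transfer of the decay exponent\<close>

text \<open>After taking logarithms and dividing by \<open>ln T\<close> the constants
  \<open>P\<close> and \<open>A\<close> vanish in the limit, leaving a lower limit of at least
  \<open>- \<delta> * p / (p - 1)\<close>, and \<open>p\<close> is arbitrary. For this reason
  \<open>A\<close> may depend on \<open>p\<close>.\<close>

lemma decays_with_exponent_sandwich:
  assumes q: "decays_with_exponent q \<delta>" and "0 < P"
    and le: "\<And>T. 0 < T \<Longrightarrow> q' T \<le> q T"
    and ge: "\<And>p. 1 < p \<Longrightarrow> \<exists>A>0. \<forall>T>0. P * root (p - 1) (A * q T ^ p) \<le> q' T"
  shows "decays_with_exponent q' \<delta>"
proof -
  have qpos: "\<forall>\<^sub>F T in at_top. 0 < q T" and qlim: "((\<lambda>T. ln (q T) / ln T) \<longlongrightarrow> - \<delta>) at_top"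
    using q by (auto simp: decays_with_exponent_def)
  have log: "0 < q' T \<and> ln P + (ln A + real p * ln (q T)) / real (p - 1) \<le> ln (q' T)"
    if "1 < p" "0 < A" "0 < q T" "P * root (p - 1) (A * q T ^ p) \<le> q' T" for p A T
  proof -
    have 0: "0 < P * root (p - 1) (A * q T ^ p)" using that \<open>0 < P\<close> by (simp add: real_root_gt_zero)
    then have "ln (P * root (p - 1) (A * q T ^ p)) \<le> ln (q' T)" using that(4) by simp
    moreover have "ln (P * root (p - 1) (A * q T ^ p)) = ln P + (ln A + real p * ln (q T)) / real (p - 1)"
      using that \<open>0 < P\<close> by (simp add: ln_mult_pos ln_root ln_realpow real_root_gt_zero)
    ultimately show ?thesis using 0 that(4) by simp
  qed
  have q'pos: "\<forall>\<^sub>F T in at_top. 0 < q' T"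
  proof -
    obtain A where A: "0 < A" "\<And>T. 0 < T \<Longrightarrow> P * root (2 - 1) (A * q T ^ 2) \<le> q' T" using ge[of 2] by auto
    from qpos eventually_gt_at_top[of 0] show ?thesis
    proof eventually_elim
      case (elim T)
      then show ?case using log[OF _ A(1) elim(1) A(2)] by simp
    qed
  qed
  have "((\<lambda>T. ln (q' T) / ln T) \<longlongrightarrow> - \<delta>) at_top"
  proof (rule order_tendstoI)
    fix l assume "- \<delta> < l"
    then have "\<forall>\<^sub>F T in at_top. ln (q T) / ln T < l" using qlim by (intro order_tendstoD(2))
    with q'pos eventually_gt_at_top[of 1] show "\<forall>\<^sub>F T in at_top. ln (q' T) / ln T < l"
    proof eventually_elim
      case (elim T)
      have "ln (q' T) \<le> ln (q T)" using elim le[of T] by simp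
      then have "ln (q' T) / ln T \<le> ln (q T) / ln T" using elim by (intro divide_right_mono) auto
      then show ?case using elim by simp
    qed
  next
    fix l assume l: "l < - \<delta>"
    have "(\<lambda>n. - \<delta> * (1 + 1 / real (Suc n))) \<longlonglongrightarrow> - \<delta> * (1 + 0)"
      by (intro tendsto_intros LIMSEQ_Suc[OF lim_1_over_n])
    then have "\<forall>\<^sub>F n in sequentially. l < - \<delta> * (1 + 1 / real (Suc n))"
      using l by (intro order_tendstoD(1)) auto
    then obtain n where n: "l < - \<delta> * (1 + 1 / real (Suc n))" by (auto simp: eventually_sequentially)
    \<comment> \<open>The ratio \<open>p / (p - 1)\<close> becomes \<open>1 + 1 / (n + 1)\<close>,
      which is close enough to 1 by the choice of \<open>n\<close>.\<close>
    define p where "p = n + 2"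
    have p: "1 < p" "real p / real (p - 1) = 1 + 1 / real (Suc n)" by (auto simp: p_def field_simps)
    obtain A where A: "0 < A" "\<And>T. 0 < T \<Longrightarrow> P * root (p - 1) (A * q T ^ p) \<le> q' T" using ge[OF p(1)] by auto
    let ?L = "\<lambda>T. (ln P + ln A / real (p - 1)) / ln T + real p / real (p - 1) * (ln (q T) / ln T)"
    have "(?L \<longlongrightarrow> 0 + real p / real (p - 1) * - \<delta>) at_top"
      by (intro tendsto_add tendsto_mult tendsto_const qlim
          tendsto_divide_0[OF tendsto_const] filterlim_at_top_imp_at_infinity ln_at_top)
    moreover have "l < 0 + real p / real (p - 1) * - \<delta>" unfolding p(2) using n by (simp add: mult.commute)
    ultimately have "\<forall>\<^sub>F T in at_top. l < ?L T" by (rule order_tendstoD(1))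
    with qpos eventually_gt_at_top[of 1] show "\<forall>\<^sub>F T in at_top. l < ln (q' T) / ln T"
    proof eventually_elim
      case (elim T)
      have "?L T = (ln P + (ln A + real p * ln (q T)) / real (p - 1)) / ln T"
        by (simp add: add_divide_distrib mult.commute)
      also have "\<dots> \<le> ln (q' T) / ln T"
        using log[OF p(1) A(1) elim(1) A(2)] elim by (intro divide_right_mono) auto
      finally show ?case using elim by simp
    qed
  qed
  then show ?thesis using q'pos by (simp add: decays_with_exponent_def)
qed

theorem theorem1:
  fixes M :: "'a measure" and X :: "real \<Rightarrow> 'a \<Rightarrow> real"
    and \<sigma>2 b \<delta> :: real and \<nu> :: "real measure"
    and f f' :: "real \<Rightarrow> real"
  assumes "levy_process M X"
    and "has_levy_triplet M X \<sigma>2 b \<nu>"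
    and "emeasure \<nu> {..<0} > 0"
    and "\<And>t. t \<ge> 0 \<Longrightarrow> f t \<ge> 0"
    and "\<And>t. t \<ge> 0 \<Longrightarrow> (f has_real_derivative f' t) (at t within {0..})"
    and "mono_on {0..} f"
    and "f 0 < 1"
    and "set_integrable lborel {1..} (\<lambda>s. (f' s)\<^sup>2)"
    and "\<exists>t0. antimono_on {t0..} f'" and "(f' \<longlongrightarrow> 0) at_top"
    and "\<delta> > 0"
    and "decays_with_exponent (prob_below M X (\<lambda>t. 1)) \<delta>"
  shows "decays_with_exponent (prob_below M X (\<lambda>t. 1 - f t)) \<delta>"
proof -
  interpret levy_process M X by fact
  obtain \<epsilon> \<rho> where "0 < \<epsilon>" "0 < \<rho>"
    "\<And>h. h \<longlonglongrightarrow> 0 \<Longrightarrow> (\<And>m::nat. 0 < h m) \<Longrightarrow>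
       \<forall>\<^sub>F m in sequentially. \<rho> * h m \<le> measure (distr M borel (X (h m))) {..-\<epsilon>}"
    using levy_negative_jump_rate[OF assms(1-3)] by blast
  then have J: "jump_rate \<epsilon> \<rho>" unfolding jump_rate_def law_def by blast
  obtain t0 where t0: "antimono_on {t0..} f'" using assms(9) by blast
  obtain P where P: "0 < P"
    "\<And>p. 1 < p \<Longrightarrow> \<exists>A>0. \<forall>T>0.
       P * root (p - 1) (A * prob_below M X (\<lambda>t. 1) T ^ p) \<le> prob_below M X (\<lambda>t. 1 - f t) T"
    using moving_boundary_comparison[OF J assms(5-7,4,8) t0 assms(10)] by blast
  show ?thesis
  proof (rule decays_with_exponent_sandwich[OF assms(12) P(1) _ P(2)])
    have "continuous (at_right t) f" if "0 \<le> t" for t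
      using DERIV_continuous[OF assms(5)[OF that]] by (rule continuous_within_subset) (use that in auto)
    then show "prob_below M X (\<lambda>t. 1 - f t) T \<le> prob_below M X (\<lambda>t. 1) T" if "0 < T" for T
      using that assms(4) by (intro prob_below_antimono continuous_intros) auto
  qed
qed

end
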